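(* Let $c=(c^I_S)$ be a system of coefficients and let $\mathcal I^c$ be the associated mutual information functional. (1) $\mathcal I^c$ is an intricacy (i.e. exchangeable and weakly additive) if and only if there exists a symmetric probability measure $\lambda_c$ on $[0,1]$ such that $$c^I_S=\int_{[0,1]}x^{|S|}(1-x)^{|I|-|S|}\,\lambda_c(dx)\qquad\text{for all finite } I\subset\mathbb N^* \text{ and all } S\subseteq I.$$ In this case, if $\{W_c,\ Y_i,\ i\in\mathbb N^*\}$ is an independent family of random variables such that $W_c$ has law $\lambda_c$ and each $Y_i$ is uniform on $[0,1]$, then, for the random subset $\mathcal Z:=\{i\in\mathbb N^*: Y_i\ge W_c\}$ of $\mathbb N^*$, $$c^I_S=\mathbb P(\mathcal Z\cap I=S)\qquad\text{for all finite } I\subset\mathbb N^*\text{ and all } S\subset I.$$ (2) If $\mathcal I^c$ is an intricacy, then $\lambda_c$ is uniquely determined by $\mathcal I^c$. Moreover $\mathcal I^c$ is non-null if and only if $\lambda_c((0,1))>0$ (open interval), and in this case $c^I_S>0$ for all finite $I\subset\mathbb N^*$ and all $S\subset I$ with $S\notin\{\emptyset,I\}$. (3) For all finite $I\subset\mathbb N^*$ and all $S\subseteq I$, $$\frac1{|I|+1}\,\frac1{\binom{|I|}{|S|}}=\int_{[0,1]}x^{|S|}(1-x)^{|I|-|S|}\,dx ,$$ i.e., for the neural complexity $\mathcal I$, which is the mutual information functional with coefficients $c^I_S=\frac1{|I|+1}\binom{|I|}{|S|}^{-1}$, $\lambda_c$ is the Lebesgue measure on $[0,1]$; and the neural complexity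 is exchangeable and weakly additive, i.e. it is an intricacy.
   Context: Notation. $\mathbb N^*=\{1,2,\dots\}$; $|I|$ is the cardinality of $I$; $0^0=1$. For a random variable $X$ with values in a finite set, the entropy is $\mathrm H(X)=-\sum_x \mathbb P(X=x)\log \mathbb P(X=x)$ (with $0\log 0=0$), and for two such variables on the same probability space $\mathrm{MI}(X,Y)=\mathrm H(X)+\mathrm H(Y)-\mathrm H(X,Y)$ is their mutual information. Systems. Let $d\ge2$ be a fixed integer. For a finite set $I\subset\mathbb N^*$, a system is a family $X=(X_i)_{i\in I}$ of random variables on a common probability space, each with values in $\{0,\dots,d-1\}$. $\mathcal X(d,I)$ is the set of such systems. For $S\subset I$: $X_S:=(X_i)_{i\in S}$ and $S^c:=I\setminus S$. A system of coefficients is a family of real numbers $c=(c^I_S)$, indexed by all finite $I\subset\mathbb N^*$ and all $S\subset I$, with $c^I_S\ge0$, $\sum_{S\subset I}c^I_S=1$ and $c^I_{S^c}=c^I_S$. The associated mutual information functional is $\mathcal I^c(X):=\sum_{S\subset I}c^I_S\,\mathrm{MI}(X_S,X_{S^c})$ for $X\in\mathcal X(d,I)$, with the convention $\mathrm{MI}(X_\emptyset,X_I)=\mathrm{MI}(X_I,X_\emptyset)=0$. It is non-null if some coefficient $c^I_S$ with $S\notin\{\emptyset,I\}$ is nonzero. $\mathcal I^c$ is exchangeable if for all finite $I,J\subset\mathbb N^*$ and every bijection $\phi:I\to J$, $\mathcal I^c(X)=\mathcal I^c(Y)$ whenever $X=(X_i)_{i\in I}$ and $Y=(X_{\phi^{-1}(j)})_{j\in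 J}$. $\mathcal I^c$ is weakly additive if $\mathcal I^c(X,Y)=\mathcal I^c(X)+\mathcal I^c(Y)$ for any two independent systems $X=(X_i)_{i\in I}$, $Y=(Y_j)_{j\in J}$ with disjoint index sets, where $(X,Y)$ is the joint system indexed by $I\sqcup J$. An intricacy is a mutual information functional that is exchangeable and weakly additive. A probability measure $\lambda$ on $[0,1]$ is symmetric if $\int f(x)\,\lambda(dx)=\int f(1-x)\,\lambda(dx)$ for all bounded measurable $f$. *)

theory Defs
  imports "HOL-Probability.Probability"
begin

section \<open>Entropy and mutual information\<close>

text \<open>The library entropy of a random variable with finite range, with natural logarithm.\<close>

definition H :: "'w measure \<Rightarrow> ('w \<Rightarrow> 'b) \<Rightarrow> real" where
  "H M X = prob_space.entropy M (exp 1) (count_space (X ` space M)) X"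

lemma H_eq_sum:
  assumes "prob_space M" and "simple_function M X"
  shows "H M X = - (\<Sum>x\<in>X ` space M. measure M {\<omega> \<in> space M. X \<omega> = x} *
                                       ln (measure M {\<omega> \<in> space M. X \<omega> = x}))"
proof -
  interpret prob_space M by fact
  interpret information_space M "exp 1"
    by unfold_locales simp
  have *: "simple_distributed M X (\<lambda>x. measure M (X -` {x} \<inter> space M))"
    by (rule simple_distributedI[OF assms(2)])
       (auto intro!: arg_cong[where f = "measure M"])
  have **: "X -` {x} \<inter> space M = {\<omega> \<in> space M. X \<omega> = x}" for x
    by auto
  show ?thesis
    using entropy_simple_distributed[OF *] unfolding H_def ** by (simp add: log_ln)
qed

definition MI :: "'w measure \<Rightarrow> ('w \<Rightarrow> 'b) \<Rightarrow> ('w \<Rightarrow> 'c) \<Rightarrow> real" where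
  "MI M X Y = H M X + H M Y - H M (\<lambda>\<omega>. (X \<omega>, Y \<omega>))"


section \<open>Systems and their functionals\<close>

text \<open>The finite index sets are the members of \<open>Fpow {1..}\<close>. A system indexed by \<open>I\<close> is given by
  a sample space \<open>M\<close> and a family \<open>X\<close> of which only the members \<open>X i\<close> with \<open>i \<in> I\<close> matter.\<close>

definition is_system :: "nat \<Rightarrow> 'w measure \<Rightarrow> nat set \<Rightarrow> (nat \<Rightarrow> 'w \<Rightarrow> nat) \<Rightarrow> bool" where
  "is_system d M I X \<longleftrightarrow>
     prob_space M \<and> I \<in> Fpow {1..} \<and> (\<forall>i\<in>I. X i \<in> M \<rightarrow>\<^sub>M count_space {0..<d})"

definition subsystem :: "(nat \<Rightarrow> 'w \<Rightarrow> nat) \<Rightarrow> nat set \<Rightarrow> 'w \<Rightarrow> (nat \<Rightarrow> nat)" where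
  "subsystem X S = (\<lambda>\<omega>. \<lambda>i\<in>S. X i \<omega>)"

type_synonym 'w functional = "'w measure \<Rightarrow> nat set \<Rightarrow> (nat \<Rightarrow> 'w \<Rightarrow> nat) \<Rightarrow> real"

definition agree :: "nat \<Rightarrow> 'w functional \<Rightarrow> 'w functional \<Rightarrow> bool" where
  "agree d F G \<longleftrightarrow> (\<forall>M I X. is_system d M I X \<longrightarrow> F M I X = G M I X)"

text \<open>A coefficient \<open>c\<^sup>I\<^sub>S\<close> is written \<open>c I S\<close>; it is only meaningful for \<open>I\<close> finite and
  \<open>S \<subseteq> I\<close>.\<close>

definition coefficient_system :: "(nat set \<Rightarrow> nat set \<Rightarrow> real) \<Rightarrow> bool" where
  "coefficient_system c \<longleftrightarrow>
     (\<forall>I \<in> Fpow {1..}.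
        (\<forall>S. S \<subseteq> I \<longrightarrow> c I S \<ge> 0 \<and> c I (I - S) = c I S) \<and> (\<Sum>S\<in>Pow I. c I S) = 1)"

text \<open>The summands for \<open>S = {}\<close> and \<open>S = I\<close> vanish, see \<open>MI_empty\<close> below, as \<open>subsystem X {}\<close> is
  constant.\<close>

definition mi_functional :: "(nat set \<Rightarrow> nat set \<Rightarrow> real) \<Rightarrow> 'w functional" where
  "mi_functional c M I X = (\<Sum>S\<in>Pow I. c I S * MI M (subsystem X S) (subsystem X (I - S)))"

definition non_null :: "(nat set \<Rightarrow> nat set \<Rightarrow> real) \<Rightarrow> bool" where
  "non_null c \<longleftrightarrow> (\<exists>I \<in> Fpow {1..}. \<exists>S. S \<subseteq> I \<and> S \<noteq> {} \<and> S \<noteq> I \<and> c I S \<noteq> 0)"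

lemma simple_function_subsystem:
  assumes "is_system d M I X" "S \<subseteq> I"
  shows "simple_function M (subsystem X S)"
proof -
  have "finite S"
    using assms by (auto simp: is_system_def Fpow_def intro: finite_subset)
  have meas: "X i \<in> M \<rightarrow>\<^sub>M count_space {0..<d}" if "i \<in> S" for i
    using assms that by (auto simp: is_system_def)
  have range: "subsystem X S ` space M \<subseteq> S \<rightarrow>\<^sub>E {0..<d}"
    using meas[THEN measurable_space] by (auto simp: subsystem_def)
  have "subsystem X S -` {f} \<inter> space M \<in> sets M" if "f \<in> subsystem X S ` space M" for f
  proof -
    have "f \<in> extensional S"
      using that by (auto simp: subsystem_def)
    then have "subsystem X S \<omega> = f \<longleftrightarrow> (\<forall>i\<in>S. X i \<omega> = f i)" for \<omega>
      by (auto simp: subsystem_def intro: extensionalityI)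
    then have "subsystem X S -` {f} \<inter> space M = space M \<inter> (\<Inter>i\<in>S. X i -` {f i} \<inter> space M)"
      by auto
    also have "\<dots> \<in> sets M"
    proof (cases "S = {}")
      case False
      have "X i -` {f i} \<inter> space M \<in> sets M" if "i \<in> S" for i
      proof -
        have "X i -` ({f i} \<inter> {0..<d}) \<inter> space M \<in> sets M"
          using meas[OF that] by (rule measurable_sets) auto
        moreover have "X i -` ({f i} \<inter> {0..<d}) \<inter> space M = X i -` {f i} \<inter> space M"
          by (auto dest: measurable_space[OF meas[OF that]])
        ultimately show ?thesis by simp
      qed
      then show ?thesis
        using False \<open>finite S\<close> by (intro sets.Int[OF sets.top sets.finite_INT])
    qed auto
    finally show ?thesis .
  qed
  moreover have "finite (subsystem X S ` space M)"
    using range by (rule finite_subset) (simp add: \<open>finite S\<close> finite_PiE)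
  ultimately show ?thesis
    by (auto simp: simple_function_def)
qed

lemma MI_empty:
  assumes "is_system d M I X"
  shows "MI M (subsystem X {}) (subsystem X I) = 0" and "MI M (subsystem X I) (subsystem X {}) = 0"
proof -
  interpret prob_space M using assms by (simp add: is_system_def)
  have e: "subsystem X {} = (\<lambda>_ _. undefined)"
    by (simp add: subsystem_def fun_eq_iff)
  have sI: "simple_function M (subsystem X I)"
    using assms by (rule simple_function_subsystem) simp
  have "subsystem X {} ` space M = {\<lambda>_. undefined}"
    using not_empty by (auto simp: e)
  then have 0: "H M (subsystem X {}) = 0"
    by (subst H_eq_sum) (auto simp: e prob_space_axioms prob_space)
  have inj: "H M (\<lambda>\<omega>. g (subsystem X I \<omega>)) = H M (subsystem X I)" if "inj g"
    for g :: "(nat \<Rightarrow> nat) \<Rightarrow> 'c"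
  proof -
    have "simple_function M (\<lambda>\<omega>. g (subsystem X I \<omega>))"
      using simple_function_compose[OF sI, of g] by (simp add: comp_def)
    moreover have "(\<lambda>\<omega>. g (subsystem X I \<omega>)) ` space M = g ` (subsystem X I ` space M)"
      by (simp add: image_image)
    moreover have "inj_on g A" for A
      using that by (rule inj_on_subset) simp
    ultimately show ?thesis
      using that by (simp add: H_eq_sum prob_space_axioms sI sum.reindex inj_eq)
  qed
  show "MI M (subsystem X {}) (subsystem X I) = 0"
    using inj[of "\<lambda>f. (subsystem X {} undefined, f)"]
    unfolding MI_def 0 by (simp add: e inj_def)
  show "MI M (subsystem X I) (subsystem X {}) = 0"
    using inj[of "\<lambda>f. (f, subsystem X {} undefined)"]
    unfolding MI_def 0 by (simp add: e inj_def)
qed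


section \<open>Intricacies\<close>

definition exchangeable :: "nat \<Rightarrow> 'w functional \<Rightarrow> bool" where
  "exchangeable d F \<longleftrightarrow>
     (\<forall>M I J \<phi> X. is_system d M I X \<and> J \<in> Fpow {1..} \<and> bij_betw \<phi> I J \<longrightarrow>
        F M I X = F M J (\<lambda>j. X (inv_into I \<phi> j)))"

definition join :: "nat set \<Rightarrow> (nat \<Rightarrow> 'w \<Rightarrow> nat) \<Rightarrow> (nat \<Rightarrow> 'w \<Rightarrow> nat) \<Rightarrow> (nat \<Rightarrow> 'w \<Rightarrow> nat)" where
  "join I X Y = (\<lambda>k. if k \<in> I then X k else Y k)"

definition independent_systems ::
  "nat \<Rightarrow> 'w measure \<Rightarrow> nat set \<Rightarrow> (nat \<Rightarrow> 'w \<Rightarrow> nat) \<Rightarrow> nat set \<Rightarrow> (nat \<Rightarrow> 'w \<Rightarrow> nat) \<Rightarrow> bool" where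
  "independent_systems d M I X J Y \<longleftrightarrow>
     prob_space.indep_var M (count_space (I \<rightarrow>\<^sub>E {0..<d})) (subsystem X I)
                            (count_space (J \<rightarrow>\<^sub>E {0..<d})) (subsystem Y J)"

definition weakly_additive :: "nat \<Rightarrow> 'w functional \<Rightarrow> bool" where
  "weakly_additive d F \<longleftrightarrow>
     (\<forall>M I J X Y. is_system d M I X \<and> is_system d M J Y \<and> I \<inter> J = {} \<and>
        independent_systems d M I X J Y \<longrightarrow>
        F M (I \<union> J) (join I X Y) = F M I X + F M J Y)"

text \<open>The sample type \<open>'w\<close> is a parameter. It carries the joint law of every system
  as soon as it is infinite.\<close>

definition intricacy :: "nat \<Rightarrow> 'w functional \<Rightarrow> bool" where
  "intricacy d F \<longleftrightarrow>
     (\<exists>c. coefficient_system c \<and> agree d F (mi_functional c)) \<and>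
     exchangeable d F \<and> weakly_additive d F"


section \<open>Representing measures\<close>

definition symmetric_prob :: "real measure \<Rightarrow> bool" where
  "symmetric_prob \<mu> \<longleftrightarrow>
     prob_space \<mu> \<and> sets \<mu> = sets (restrict_space borel {0..1}) \<and>
     (\<forall>f \<in> borel_measurable \<mu>. bounded (f ` {0..1}) \<longrightarrow>
        (\<integral>x. f x \<partial>\<mu>) = ((\<integral>x. f (1 - x) \<partial>\<mu>) :: real))"

definition represents :: "real measure \<Rightarrow> (nat set \<Rightarrow> nat set \<Rightarrow> real) \<Rightarrow> bool" where
  "represents \<mu> c \<longleftrightarrow>
     symmetric_prob \<mu> \<and>
     (\<forall>I \<in> Fpow {1..}. \<forall>S. S \<subseteq> I \<longrightarrow>
        c I S = (\<integral>x. x ^ card S * (1 - x) ^ (card I - card S) \<partial>\<mu>))"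

definition lebesgue01 :: "real measure" where
  "lebesgue01 = restrict_space lborel {0..1}"

text \<open>\<open>W\<close> and \<open>Y i\<close> may be any real random variables whose laws are carried by \<open>[0,1]\<close>, so
  the measure \<open>\<mu>\<close> on \<open>[0,1]\<close> is pushed to the real line. In the index type of the joint family
  \<open>None\<close> stands for \<open>W\<close> and \<open>Some i\<close> for \<open>Y i\<close>.\<close>

definition sampling_family ::
  "real measure \<Rightarrow> 'v measure \<Rightarrow> ('v \<Rightarrow> real) \<Rightarrow> (nat \<Rightarrow> 'v \<Rightarrow> real) \<Rightarrow> bool" where
  "sampling_family \<mu> N W Y \<longleftrightarrow>
     prob_space N \<and>
     prob_space.indep_vars N (\<lambda>_. borel) (case_option W Y) (insert None (Some ` {1..})) \<and>
     distr N borel W = distr \<mu> borel (\<lambda>x. x) \<and>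
     (\<forall>i\<ge>1. distr N borel (Y i) = uniform_measure lborel {0..1})"

definition random_set :: "('v \<Rightarrow> real) \<Rightarrow> (nat \<Rightarrow> 'v \<Rightarrow> real) \<Rightarrow> 'v \<Rightarrow> nat set" where
  "random_set W Y \<omega> = {i \<in> {1..}. Y i \<omega> \<ge> W \<omega>}"

definition neural_coeff :: "nat set \<Rightarrow> nat set \<Rightarrow> real" where
  "neural_coeff I S = 1 / (real (card I) + 1) * (1 / real (card I choose card S))"

end

theory Submission
  imports Defs
begin

text \<open>For fixed \<open>I\<close> the coefficients form the law of a random subset \<open>Z\<close> of \<open>I\<close>. With \<open>h S\<close> the entropy of
  \<open>X\<^sub>S\<close>, the symmetry \<open>c\<^sup>I\<^sub>S = c\<^sup>I\<^sub>I\<^sub>-\<^sub>S\<close> turns the functional into \<open>2 * (\<Sum>S. c I S * h S) - h I\<close>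
  (\<open>mi_functional_eq_sum_H\<close>), and everything is read off from this form.

  A functional with a representing measure is an intricacy: its coefficients depend on cardinalities only,
  which gives exchangeability, and the coefficients on \<open>I \<union> J\<close> have those on \<open>I\<close> and \<open>J\<close> as marginals,
  because \<open>x + (1 - x) = 1\<close>. Since entropy is additive over independent parts, weak additivity follows.

  Conversely, test the functional on a single fair bit copied onto a set \<open>K\<close> of sites, all other sites being
  constant. Its value is \<open>ln 2 * (1 - 2 * P(K \<subseteq> Z))\<close> (\<open>mi_functional_copied_bit\<close>), so the functional
  determines all the probabilities \<open>P(K \<subseteq> Z)\<close>. Exchangeability makes them invariant under bijections,
  and adjoining independent constants shows through weak additivity that they do not depend on \<open>I \<supseteq> K\<close>.
  Hence \<open>P(K \<subseteq> Z) = m (card K)\<close> for a single sequence \<open>m\<close>.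

  That \<open>m\<close> is a moment sequence is the finite form of de Finetti's theorem: the frequencies
  \<open>|Z \<inter> {1..n}| / n\<close> have \<open>k\<close>-th moments tending to \<open>m k\<close>, and by Helly's selection theorem a subsequence
  of their laws converges weakly to a probability measure \<open>\<mu>\<close> on \<open>[0,1]\<close>
  (\<open>containment_moments_have_measure\<close>). The containment probabilities determine the coefficients by
  inversion on the subset lattice, so \<open>c\<close> is the Bernoulli mixture of \<open>\<mu>\<close>. On \<open>[0,1]\<close> moments determine
  the measure (\<open>moments_determine_measure\<close>), which yields both the uniqueness of \<open>\<mu>\<close> and, as \<open>x\<close> and
  \<open>1 - x\<close> have the same moments, its symmetry.

  The remaining claims are computations with a known measure: the integrand
  \<open>x\<^sup>s * (1 - x)\<^sup>t\<close> with \<open>s, t > 0\<close> is positive exactly on the open interval, the integral against Lebesgue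
  measure is a Beta integral, and given \<open>W = w\<close> the events \<open>i \<in> Z\<close> are independent with
  probability \<open>1 - w\<close>.\<close>

section \<open>Entropy under injective maps and independence\<close>

lemma H_inj_comp:
  assumes "prob_space M" "simple_function M X" "inj_on g (X ` space M)"
  shows "H M (\<lambda>\<omega>. g (X \<omega>)) = H M X"
proof -
  have s: "simple_function M (\<lambda>\<omega>. g (X \<omega>))"
    using simple_function_compose[OF assms(2), of g] by (simp add: comp_def)
  have im: "(\<lambda>\<omega>. g (X \<omega>)) ` space M = g ` (X ` space M)"
    by (simp add: image_image)
  have "{\<omega> \<in> space M. g (X \<omega>) = g x} = {\<omega> \<in> space M. X \<omega> = x}" if "x \<in> X ` space M" for x
    using assms(3) that by (auto dest: inj_onD)
  then show ?thesis
    by (simp add: H_eq_sum[OF assms(1) s] H_eq_sum[OF assms(1,2)] im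
        sum.reindex[OF assms(3)] cong: sum.cong)
qed

text \<open>Values outside the range have probability zero and contribute \<open>0 * ln 0 = 0\<close>.\<close>

lemma H_eq_sum_superset:
  assumes "prob_space M" "simple_function M X" "finite A" "X ` space M \<subseteq> A"
  shows "H M X = - (\<Sum>x\<in>A. measure M {\<omega> \<in> space M. X \<omega> = x} *
                              ln (measure M {\<omega> \<in> space M. X \<omega> = x}))"
proof -
  have "measure M {\<omega> \<in> space M. X \<omega> = x} = 0" if "x \<notin> X ` space M" for x
  proof -
    have "{\<omega> \<in> space M. X \<omega> = x} = {}" using that by auto
    then show ?thesis by (simp only: measure_empty)
  qed
  then show ?thesis
    unfolding H_eq_sum[OF assms(1,2)] using assms(3,4)
    by (intro arg_cong[where f = uminus] sum.mono_neutral_left) auto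
qed

lemma sum_prob_simple_function:
  assumes "prob_space M" "simple_function M X"
  shows "(\<Sum>x\<in>X ` space M. measure M {\<omega> \<in> space M. X \<omega> = x}) = 1"
proof -
  interpret prob_space M by fact
  have "(\<Sum>x\<in>X ` space M. measure M {\<omega> \<in> space M. X \<omega> = x}) =
        measure M (\<Union>x\<in>X ` space M. {\<omega> \<in> space M. X \<omega> = x})"
    using assms(2)
    by (intro finite_measure_finite_Union[symmetric])
       (auto simp: simple_function_def disjoint_family_on_def vimage_def Int_def conj_commute)
  also have "(\<Union>x\<in>X ` space M. {\<omega> \<in> space M. X \<omega> = x}) = space M"
    by auto
  finally show ?thesis by (simp add: prob_space)
qed

text \<open>The logarithm turns the product of the marginal laws into a sum, and each marginal law has
  total mass one.\<close>

lemma H_indep_pair: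
  assumes M: "prob_space M" and X: "simple_function M X" and Y: "simple_function M Y"
    and indep: "\<And>x y. measure M {\<omega> \<in> space M. X \<omega> = x \<and> Y \<omega> = y} =
                  measure M {\<omega> \<in> space M. X \<omega> = x} * measure M {\<omega> \<in> space M. Y \<omega> = y}"
  shows "H M (\<lambda>\<omega>. (X \<omega>, Y \<omega>)) = H M X + H M Y"
proof -
  define p where "p x = measure M {\<omega> \<in> space M. X \<omega> = x}" for x
  define q where "q y = measure M {\<omega> \<in> space M. Y \<omega> = y}" for y
  let ?A = "X ` space M" and ?B = "Y ` space M"
  have fin: "finite ?A" "finite ?B"
    using X Y by (auto simp: simple_function_def)
  have pq: "measure M {\<omega> \<in> space M. (X \<omega>, Y \<omega>) = z} = p (fst z) * q (snd z)" for z
    using indep[of "fst z" "snd z"] by (cases z) (simp add: p_def q_def)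
  have "H M (\<lambda>\<omega>. (X \<omega>, Y \<omega>)) = - (\<Sum>z\<in>?A \<times> ?B. p (fst z) * q (snd z) * ln (p (fst z) * q (snd z)))"
    unfolding pq[symmetric] using fin
    by (intro H_eq_sum_superset M simple_function_Pair X Y) auto
  also have "(\<Sum>z\<in>?A \<times> ?B. p (fst z) * q (snd z) * ln (p (fst z) * q (snd z))) =
             (\<Sum>x\<in>?A. \<Sum>y\<in>?B. p x * q y * ln (p x * q y))"
    by (simp add: sum.cartesian_product split_def)
  also have "\<dots> = (\<Sum>x\<in>?A. \<Sum>y\<in>?B. p x * ln (p x) * q y + p x * (q y * ln (q y)))"
  proof (intro sum.cong refl)
    fix x y
    have "p x \<ge> 0" "q y \<ge> 0" by (simp_all add: p_def q_def)
    then show "p x * q y * ln (p x * q y) = p x * ln (p x) * q y + p x * (q y * ln (q y))"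
      by (cases "p x = 0 \<or> q y = 0") (auto simp: ln_mult algebra_simps)
  qed
  also have "\<dots> = (\<Sum>x\<in>?A. p x * ln (p x)) * (\<Sum>y\<in>?B. q y) + (\<Sum>x\<in>?A. p x) * (\<Sum>y\<in>?B. q y * ln (q y))"
    by (simp add: sum.distrib sum_product)
  also have "\<dots> = (\<Sum>x\<in>?A. p x * ln (p x)) + (\<Sum>y\<in>?B. q y * ln (q y))"
    using sum_prob_simple_function[OF M X] sum_prob_simple_function[OF M Y]
    by (simp add: p_def q_def)
  finally show ?thesis
    by (simp add: H_eq_sum[OF M X] H_eq_sum[OF M Y] p_def q_def)
qed

section \<open>The functional as a weighted sum of entropies\<close>

lemma H_subsystem_Un:
  assumes X: "is_system d M I X" and ST: "S \<subseteq> I" "T \<subseteq> I"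
  shows "H M (subsystem X (S \<union> T)) = H M (\<lambda>\<omega>. (subsystem X S \<omega>, subsystem X T \<omega>))"
proof -
  have M: "prob_space M" using X by (simp add: is_system_def)
  define g :: "(nat \<Rightarrow> nat) \<Rightarrow> (nat \<Rightarrow> nat) \<times> (nat \<Rightarrow> nat)"
    where "g = (\<lambda>f. (restrict f S, restrict f T))"
  have "inj_on g (subsystem X (S \<union> T) ` space M)"
  proof (rule inj_onI)
    fix f f' assume f: "f \<in> subsystem X (S \<union> T) ` space M" "f' \<in> subsystem X (S \<union> T) ` space M"
      and eq: "g f = g f'"
    have "h i = (if i \<in> S then fst (g h) i else if i \<in> T then snd (g h) i else undefined)"
      if "h \<in> subsystem X (S \<union> T) ` space M" for h i
      using that by (auto simp: g_def subsystem_def)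
    from this[OF f(1)] this[OF f(2)] eq show "f = f'" by (intro ext) simp
  qed
  from H_inj_comp[OF M simple_function_subsystem[OF X] this] ST
  have "H M (\<lambda>\<omega>. g (subsystem X (S \<union> T) \<omega>)) = H M (subsystem X (S \<union> T))" by simp
  moreover have "(\<lambda>\<omega>. g (subsystem X (S \<union> T) \<omega>)) = (\<lambda>\<omega>. (subsystem X S \<omega>, subsystem X T \<omega>))"
    by (auto simp: g_def subsystem_def fun_eq_iff restrict_def)
  ultimately show ?thesis by simp
qed

lemma MI_subsystem:
  assumes X: "is_system d M I X" and S: "S \<subseteq> I"
  shows "MI M (subsystem X S) (subsystem X (I - S)) =
         H M (subsystem X S) + H M (subsystem X (I - S)) - H M (subsystem X I)"
  using H_subsystem_Un[OF X S, of "I - S"] S by (simp add: MI_def Un_absorb1)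

lemma coefficient_systemD:
  assumes "coefficient_system c" "I \<in> Fpow {1..}"
  shows "S \<subseteq> I \<Longrightarrow> 0 \<le> c I S" "S \<subseteq> I \<Longrightarrow> c I (I - S) = c I S" "(\<Sum>S\<in>Pow I. c I S) = 1"
  using assms by (auto simp: coefficient_system_def)

lemma sum_Pow_compl: "(\<Sum>S\<in>Pow I. f (I - S)) = (\<Sum>S\<in>Pow I. f S)"
  by (rule sum.reindex_bij_witness[of _ "\<lambda>S. I - S" "\<lambda>S. I - S"]) (auto simp: double_diff)

text \<open>The symmetry of the coefficients makes both halves of every split contribute equally.\<close>

lemma mi_functional_eq_sum_H:
  assumes c: "coefficient_system c" and X: "is_system d M I X"
  shows "mi_functional c M I X =
         2 * (\<Sum>S\<in>Pow I. c I S * H M (subsystem X S)) - H M (subsystem X I)"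
proof -
  have I: "I \<in> Fpow {1..}" using X by (simp add: is_system_def)
  let ?h = "\<lambda>S. H M (subsystem X S)"
  have "mi_functional c M I X =
        (\<Sum>S\<in>Pow I. c I S * ?h S + c I (I - S) * ?h (I - S) - c I S * ?h I)"
    unfolding mi_functional_def
    by (intro sum.cong refl)
       (simp add: MI_subsystem[OF X] coefficient_systemD(2)[OF c I] algebra_simps)
  also have "\<dots> = (\<Sum>S\<in>Pow I. c I S * ?h S) + (\<Sum>S\<in>Pow I. c I (I - S) * ?h (I - S))
                   - (\<Sum>S\<in>Pow I. c I S) * ?h I"
    by (simp add: sum.distrib sum_subtractf sum_distrib_right)
  also have "\<dots> = 2 * (\<Sum>S\<in>Pow I. c I S * ?h S) - ?h I"
    by (simp add: sum_Pow_compl[of "\<lambda>S. c I S * ?h S"] coefficient_systemD(3)[OF c I])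
  finally show ?thesis .
qed

section \<open>Coefficients and the masses of upper sets\<close>

text \<open>If \<open>c I\<close> is the law of a random subset of \<open>I\<close>, this is the probability that it contains
  \<open>K\<close>.\<close>

definition containment_prob :: "(nat set \<Rightarrow> nat set \<Rightarrow> real) \<Rightarrow> nat set \<Rightarrow> nat set \<Rightarrow> real" where
  "containment_prob c I K = (\<Sum>S | K \<subseteq> S \<and> S \<subseteq> I. c I S)"

lemma containment_prob_eq_sum_if:
  assumes "finite I"
  shows "containment_prob c I K = (\<Sum>S\<in>Pow I. if K \<subseteq> S then c I S else 0)"
proof -
  have "{S. K \<subseteq> S \<and> S \<subseteq> I} = {S \<in> Pow I. K \<subseteq> S}" by auto
  then show ?thesis
    using assms by (simp add: containment_prob_def sum.inter_filter del: Pow_iff)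
qed

lemma containment_prob_empty:
  assumes "coefficient_system c" "I \<in> Fpow {1..}"
  shows "containment_prob c I {} = 1"
  using coefficient_systemD(3)[OF assms] by (simp add: containment_prob_def Pow_def)

lemma containment_prob_self: "containment_prob c K K = c K K"
proof -
  have "{S. K \<subseteq> S \<and> S \<subseteq> K} = {K}" by auto
  then show ?thesis by (simp add: containment_prob_def)
qed

text \<open>A qualitative form of Moebius inversion on the subset lattice: in the sum over the sets
  above \<open>S\<close> all terms but the one at \<open>S\<close> agree by downward induction.\<close>

lemma eq_if_superset_sums_eq:
  fixes f g :: "'a set \<Rightarrow> 'b::cancel_comm_monoid_add"
  assumes I: "finite I"
    and eq: "\<And>K. K \<subseteq> I \<Longrightarrow> (\<Sum>S | K \<subseteq> S \<and> S \<subseteq> I. f S) = (\<Sum>S | K \<subseteq> S \<and> S \<subseteq> I. g S)"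
    and "S \<subseteq> I"
  shows "f S = g S"
  using \<open>S \<subseteq> I\<close>
proof (induction "card (I - S)" arbitrary: S rule: less_induct)
  case less
  have split: "{T. S \<subseteq> T \<and> T \<subseteq> I} = insert S {T. S \<subset> T \<and> T \<subseteq> I}"
    using less.prems by auto
  have fin: "finite {T. S \<subset> T \<and> T \<subseteq> I}"
    using I by (auto intro: finite_subset[of _ "Pow I"])
  have "(\<Sum>T | S \<subset> T \<and> T \<subseteq> I. f T) = (\<Sum>T | S \<subset> T \<and> T \<subseteq> I. g T)"
  proof (intro sum.cong refl less.hyps)
    fix T assume "T \<in> {T. S \<subset> T \<and> T \<subseteq> I}"
    then show "card (I - T) < card (I - S)" "T \<subseteq> I"
      using I by (auto intro!: psubset_card_mono)
  qed
  then show ?case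
    using eq[OF less.prems] fin by (simp add: split)
qed

section \<open>Invariance of the coefficients implies invariance of the functional\<close>

text \<open>Relabelling the sites replaces \<open>X\<^sub>S\<close> by an injective image of itself, which has the same entropy.\<close>

lemma exchangeable_if_coefficients:
  assumes c: "coefficient_system c"
    and inv: "\<And>I J \<phi> S. I \<in> Fpow {1..} \<Longrightarrow> J \<in> Fpow {1..} \<Longrightarrow> bij_betw \<phi> I J \<Longrightarrow> S \<subseteq> I \<Longrightarrow>
                c J (\<phi> ` S) = c I S"
  shows "exchangeable d (mi_functional c)"
  unfolding exchangeable_def
proof (intro allI impI, elim conjE)
  fix M :: "'w measure" and I J :: "nat set" and \<phi> X
  assume X: "is_system d M I X" and J: "J \<in> Fpow {1..}" and \<phi>: "bij_betw \<phi> I J"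
  have M: "prob_space M" and I: "I \<in> Fpow {1..}" using X by (simp_all add: is_system_def)
  define Y where "Y j = X (inv_into I \<phi> j)" for j
  have inj: "inj_on \<phi> I" and J_eq: "J = \<phi> ` I" using \<phi> by (simp_all add: bij_betw_def)
  have Y_\<phi>: "Y (\<phi> i) = X i" if "i \<in> I" for i
    using that inj by (simp add: Y_def)
  have Y: "is_system d M J Y"
    using X J Y_\<phi> by (auto simp: is_system_def J_eq)
  have H: "H M (subsystem Y (\<phi> ` S)) = H M (subsystem X S)" if S: "S \<subseteq> I" for S
  proof -
    define g :: "(nat \<Rightarrow> nat) \<Rightarrow> nat \<Rightarrow> nat"
      where "g f = (\<lambda>j\<in>\<phi> ` S. f (inv_into I \<phi> j))" for f
    have "inj_on g (subsystem X S ` space M)"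
    proof (rule inj_onI)
      fix f f' assume f: "f \<in> subsystem X S ` space M" "f' \<in> subsystem X S ` space M"
        and eq: "g f = g f'"
      have "h i = (if i \<in> S then g h (\<phi> i) else undefined)" if "h \<in> subsystem X S ` space M" for h i
        using that S inj by (auto simp: g_def subsystem_def subset_iff)
      from this[OF f(1)] this[OF f(2)] eq show "f = f'" by (intro ext) simp
    qed
    from H_inj_comp[OF M simple_function_subsystem[OF X S] this]
    have "H M (\<lambda>\<omega>. g (subsystem X S \<omega>)) = H M (subsystem X S)" .
    moreover have "(\<lambda>\<omega>. g (subsystem X S \<omega>)) = subsystem Y (\<phi> ` S)"
      using S inj by (auto simp: g_def subsystem_def Y_def fun_eq_iff restrict_def subset_iff)
    ultimately show ?thesis by simp
  qed
  have "(\<Sum>S\<in>Pow J. c J S * H M (subsystem Y S)) =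
        (\<Sum>S\<in>Pow I. c J (\<phi> ` S) * H M (subsystem Y (\<phi> ` S)))"
    using inj_on_image_Pow[OF inj] unfolding J_eq image_Pow_surj[OF refl, symmetric]
    by (subst sum.reindex) auto
  also have "\<dots> = (\<Sum>S\<in>Pow I. c I S * H M (subsystem X S))"
    by (intro sum.cong refl) (simp add: H inv[OF I J \<phi>])
  finally have "(\<Sum>S\<in>Pow J. c J S * H M (subsystem Y S)) = (\<Sum>S\<in>Pow I. c I S * H M (subsystem X S))" .
  then have "mi_functional c M I X = mi_functional c M J Y"
    using H[of I] unfolding mi_functional_eq_sum_H[OF c X] mi_functional_eq_sum_H[OF c Y]
    by (simp add: J_eq)
  then show "mi_functional c M I X = mi_functional c M J (\<lambda>j. X (inv_into I \<phi> j))"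
    by (simp add: Y_def[abs_def])
qed

lemma sum_Pow_Un_disjoint:
  assumes "I \<inter> J = {}"
  shows "(\<Sum>U\<in>Pow (I \<union> J). f U) = (\<Sum>S\<in>Pow I. \<Sum>T\<in>Pow J. f (S \<union> T))"
proof -
  have "(\<Sum>U\<in>Pow (I \<union> J). f U) = (\<Sum>(S,T)\<in>Pow I \<times> Pow J. f (S \<union> T))"
    using assms
    by (intro sum.reindex_bij_witness[of _ "\<lambda>(S,T). S \<union> T" "\<lambda>U. (U \<inter> I, U \<inter> J)"])
       (auto simp: Int_Un_distrib2 Int_absorb2 simp flip: Int_Un_distrib)
  then show ?thesis by (simp add: sum.cartesian_product)
qed

lemma is_system_join:
  assumes "is_system d M I X" "is_system d M J Y"
  shows "is_system d M (I \<union> J) (join I X Y)"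
  using assms by (auto simp: is_system_def join_def Fpow_def)

text \<open>Independence is assumed for the full systems; it passes to \<open>X\<^sub>S\<close> and \<open>Y\<^sub>T\<close> because these are restrictions
  of the full systems.\<close>

lemma H_join:
  assumes X: "is_system d M I X" and Y: "is_system d M J Y" and IJ: "I \<inter> J = {}"
    and ind: "independent_systems d M I X J Y" and S: "S \<subseteq> I" and T: "T \<subseteq> J"
  shows "H M (subsystem (join I X Y) (S \<union> T)) = H M (subsystem X S) + H M (subsystem Y T)"
proof -
  have M: "prob_space M" using X by (simp add: is_system_def)
  interpret prob_space M by fact
  have jS: "subsystem (join I X Y) S = subsystem X S" and jT: "subsystem (join I X Y) T = subsystem Y T"
    using S T IJ by (auto simp: subsystem_def join_def fun_eq_iff restrict_def)
  have rX: "subsystem X I \<omega> \<in> I \<rightarrow>\<^sub>E {0..<d}" and rY: "subsystem Y J \<omega> \<in> J \<rightarrow>\<^sub>E {0..<d}"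
    if "\<omega> \<in> space M" for \<omega>
    using X Y that by (auto simp: subsystem_def is_system_def dest!: bspec measurable_space)
  have "measure M {\<omega> \<in> space M. subsystem X S \<omega> = x \<and> subsystem Y T \<omega> = y} =
        measure M {\<omega> \<in> space M. subsystem X S \<omega> = x} * measure M {\<omega> \<in> space M. subsystem Y T \<omega> = y}"
    for x y
  proof -
    let ?A = "{f \<in> I \<rightarrow>\<^sub>E {0..<d}. restrict f S = x}" and ?B = "{f \<in> J \<rightarrow>\<^sub>E {0..<d}. restrict f T = y}"
    have sub: "subsystem X S \<omega> = restrict (subsystem X I \<omega>) S"
      "subsystem Y T \<omega> = restrict (subsystem Y J \<omega>) T" for \<omega>
      using S T by (auto simp: subsystem_def Int_absorb1)
    have "(\<lambda>\<omega>. (subsystem X I \<omega>, subsystem Y J \<omega>)) -` (?A \<times> ?B) \<inter> space M =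
          {\<omega> \<in> space M. subsystem X S \<omega> = x \<and> subsystem Y T \<omega> = y}"
      using rX rY unfolding sub by blast+
    moreover have "subsystem X I -` ?A \<inter> space M = {\<omega> \<in> space M. subsystem X S \<omega> = x}"
      "subsystem Y J -` ?B \<inter> space M = {\<omega> \<in> space M. subsystem Y T \<omega> = y}"
      using rX rY unfolding sub by blast+
    ultimately show ?thesis
      using indep_varD[OF ind[unfolded independent_systems_def], of ?A ?B] by auto
  qed
  from H_indep_pair[OF M simple_function_subsystem[OF X S] simple_function_subsystem[OF Y T] this]
  show ?thesis
    using H_subsystem_Un[OF is_system_join[OF X Y], of S T] S T by (auto simp: jS jT)
qed

text \<open>The entropy of the joint system splits as \<open>H(X\<^sub>S) + H(Y\<^sub>T)\<close>, so only the two marginals of the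
  coefficients on \<open>I \<union> J\<close> matter; by assumption these are the coefficients on \<open>I\<close> and \<open>J\<close>.\<close>

lemma weakly_additive_if_coefficients:
  assumes c: "coefficient_system c"
    and marg: "\<And>I J S. I \<in> Fpow {1..} \<Longrightarrow> J \<in> Fpow {1..} \<Longrightarrow> I \<inter> J = {} \<Longrightarrow> S \<subseteq> I \<Longrightarrow>
                 (\<Sum>T\<in>Pow J. c (I \<union> J) (S \<union> T)) = c I S"
  shows "weakly_additive d (mi_functional c)"
  unfolding weakly_additive_def
proof (intro allI impI, elim conjE)
  fix M :: "'w measure" and I J X Y
  assume X: "is_system d M I X" and Y: "is_system d M J Y" and IJ: "I \<inter> J = {}"
    and ind: "independent_systems d M I X J Y"
  have I: "I \<in> Fpow {1..}" and J: "J \<in> Fpow {1..}" using X Y by (simp_all add: is_system_def)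
  let ?Z = "join I X Y"
  have Z: "is_system d M (I \<union> J) ?Z" using X Y by (rule is_system_join)
  have "(\<Sum>U\<in>Pow (I \<union> J). c (I \<union> J) U * H M (subsystem ?Z U)) =
        (\<Sum>S\<in>Pow I. \<Sum>T\<in>Pow J. c (I \<union> J) (S \<union> T) * (H M (subsystem X S) + H M (subsystem Y T)))"
    unfolding sum_Pow_Un_disjoint[OF IJ]
    by (intro sum.cong refl) (simp add: H_join[OF X Y IJ ind])
  also have "\<dots> = (\<Sum>S\<in>Pow I. (\<Sum>T\<in>Pow J. c (I \<union> J) (S \<union> T)) * H M (subsystem X S)) +
                   (\<Sum>S\<in>Pow I. \<Sum>T\<in>Pow J. c (I \<union> J) (S \<union> T) * H M (subsystem Y T))"
    by (simp add: distrib_left sum.distrib sum_distrib_right)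
  also have "(\<Sum>S\<in>Pow I. \<Sum>T\<in>Pow J. c (I \<union> J) (S \<union> T) * H M (subsystem Y T)) =
             (\<Sum>T\<in>Pow J. (\<Sum>S\<in>Pow I. c (J \<union> I) (T \<union> S)) * H M (subsystem Y T))"
    by (subst sum.swap) (simp add: sum_distrib_right Un_commute)
  also have "(\<Sum>S\<in>Pow I. (\<Sum>T\<in>Pow J. c (I \<union> J) (S \<union> T)) * H M (subsystem X S)) =
             (\<Sum>S\<in>Pow I. c I S * H M (subsystem X S))"
    by (intro sum.cong refl) (simp add: marg[OF I J IJ])
  also have "(\<Sum>T\<in>Pow J. (\<Sum>S\<in>Pow I. c (J \<union> I) (T \<union> S)) * H M (subsystem Y T)) =
             (\<Sum>T\<in>Pow J. c J T * H M (subsystem Y T))"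
    using IJ by (intro sum.cong refl) (simp add: marg[OF J I] Int_commute)
  finally show "mi_functional c M (I \<union> J) ?Z = mi_functional c M I X + mi_functional c M J Y"
    by (simp add: mi_functional_eq_sum_H[OF c X] mi_functional_eq_sum_H[OF c Y]
        mi_functional_eq_sum_H[OF c Z] H_join[OF X Y IJ ind])
qed

section \<open>A fair bit copied onto a set of sites\<close>

definition copied_bit :: "'w \<Rightarrow> nat set \<Rightarrow> nat \<Rightarrow> 'w \<Rightarrow> nat" where
  "copied_bit a K i \<omega> = (if i \<in> K \<and> \<omega> = a then 1 else 0)"

lemma prob_space_coin: "prob_space (uniform_count_measure {a, b})"
  by (rule prob_space_uniform_count_measure) auto

lemma is_system_copied_bit:
  assumes "d \<ge> 2" "I \<in> Fpow {1..}"
  shows "is_system d (uniform_count_measure {a, b}) I (copied_bit a K)"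
  using assms prob_space_coin[of a b]
  by (auto simp: is_system_def measurable_def copied_bit_def space_uniform_count_measure
      sets_uniform_count_measure)

lemma H_copied_bit:
  assumes "a \<noteq> b" "I \<in> Fpow {1..}" "S \<subseteq> I"
  shows "H (uniform_count_measure {a, b}) (subsystem (copied_bit a K) S) =
         (if S \<inter> K = {} then 0 else ln 2)"
proof -
  let ?M = "uniform_count_measure {a, b}" and ?X = "subsystem (copied_bit a K) S"
  have H: "H ?M ?X = - (\<Sum>x\<in>?X ` {a, b}. measure ?M {\<omega> \<in> {a, b}. ?X \<omega> = x} *
                                       ln (measure ?M {\<omega> \<in> {a, b}. ?X \<omega> = x}))"
    using H_eq_sum[OF prob_space_coin[of a b]
        simple_function_subsystem[OF is_system_copied_bit[OF order_refl assms(2), of a b K] assms(3)]]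
    by (simp add: space_uniform_count_measure)
  show ?thesis
  proof (cases "S \<inter> K = {}")
    case True
    then have "?X a = ?X b" by (auto simp: subsystem_def copied_bit_def fun_eq_iff)
    then have "?X ` {a, b} = {?X b}" "{\<omega> \<in> {a, b}. ?X \<omega> = ?X b} = {a, b}" by auto
    with H True prob_space.prob_space[OF prob_space_coin[of a b]] show ?thesis
      by (simp add: space_uniform_count_measure)
  next
    case False
    then obtain i where "i \<in> S" "i \<in> K" by auto
    then have "?X a i \<noteq> ?X b i" using \<open>a \<noteq> b\<close> by (auto simp: subsystem_def copied_bit_def)
    then have neq: "?X a \<noteq> ?X b" by auto
    then have eq: "{\<omega> \<in> {a, b}. ?X \<omega> = ?X a} = {a}" "{\<omega> \<in> {a, b}. ?X \<omega> = ?X b} = {b}" by auto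
    have half: "measure ?M {a} = 1 / 2" "measure ?M {b} = 1 / 2"
      using \<open>a \<noteq> b\<close> by (simp_all add: measure_uniform_count_measure)
    have "H ?M ?X = - (1 / 2 * ln (1 / 2) + 1 / 2 * ln (1 / 2))"
      using H neq eq by (simp add: half)
    with False show ?thesis by (simp add: ln_div)
  qed
qed

text \<open>The two sides of the split \<open>S, I - S\<close> share exactly one bit of information if both meet \<open>K\<close>, and
  none otherwise. By the symmetry of the coefficients the splits of the second kind have mass
  \<open>2 * containment_prob c I K\<close>.\<close>

lemma mi_functional_copied_bit:
  assumes "a \<noteq> b" and c: "coefficient_system c" and I: "I \<in> Fpow {1..}"
    and K: "K \<subseteq> I" "K \<noteq> {}"
  shows "mi_functional c (uniform_count_measure {a, b}) I (copied_bit a K) =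
         ln 2 * (1 - 2 * containment_prob c I K)"
proof -
  have fin: "finite I" using I by (simp add: Fpow_def)
  let ?h = "\<lambda>S. H (uniform_count_measure {a, b}) (subsystem (copied_bit a K) S)"
  have "(\<Sum>S\<in>Pow I. c I S * ?h S) = (\<Sum>S\<in>Pow I. c I S * (if S \<inter> K = {} then 0 else ln 2))"
    by (intro sum.cong refl) (simp add: H_copied_bit[OF assms(1) I])
  also have "\<dots> = ln 2 * ((\<Sum>S\<in>Pow I. c I S) - (\<Sum>S\<in>Pow I. if S \<inter> K = {} then c I S else 0))"
    by (simp add: sum_distrib_left right_diff_distrib flip: sum_subtractf) (intro sum.cong, auto)
  also have "(\<Sum>S\<in>Pow I. if S \<inter> K = {} then c I S else 0) =
             (\<Sum>S\<in>Pow I. if (I - S) \<inter> K = {} then c I (I - S) else 0)"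
    by (rule sum_Pow_compl[symmetric])
  also have "\<dots> = (\<Sum>S\<in>Pow I. if K \<subseteq> S then c I S else 0)"
    using K(1) by (intro sum.cong refl) (auto simp: coefficient_systemD(2)[OF c I])
  also have "\<dots> = containment_prob c I K"
    by (rule containment_prob_eq_sum_if[OF fin, symmetric])
  finally have "(\<Sum>S\<in>Pow I. c I S * ?h S) = ln 2 * (1 - containment_prob c I K)"
    by (simp add: coefficient_systemD(3)[OF c I])
  moreover have "I \<inter> K \<noteq> {}" using K by auto
  ultimately show ?thesis
    by (simp add: mi_functional_eq_sum_H[OF c is_system_copied_bit[OF order_refl I]]
        H_copied_bit[OF assms(1) I] algebra_simps)
qed

lemma ex_two_points: "infinite (UNIV :: 'w set) \<Longrightarrow> \<exists>a b :: 'w. a \<noteq> b"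
  by (metis (full_types) UNIV_I ex_new_if_finite finite.emptyI finite_insert insertI1)

lemma mi_functional_cong:
  assumes "\<And>i. i \<in> I \<Longrightarrow> X i = Y i"
  shows "mi_functional c M I X = mi_functional c M I Y"
proof -
  have "subsystem X S = subsystem Y S" if "S \<subseteq> I" for S
    using assms that by (auto simp: subsystem_def fun_eq_iff)
  then show ?thesis unfolding mi_functional_def by (intro sum.cong) auto
qed

text \<open>A copied bit lives on two sample points, so every infinite sample type carries these test systems, and
  their values determine the containment probabilities.\<close>

lemma agree_imp_containment_prob_eq:
  assumes "infinite (UNIV :: 'w set)" "d \<ge> 2" and c: "coefficient_system c" "coefficient_system c'"
    and agree: "agree d (mi_functional c :: 'w functional) (mi_functional c')"
    and I: "I \<in> Fpow {1..}" and K: "K \<subseteq> I"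
  shows "containment_prob c I K = containment_prob c' I K"
proof (cases "K = {}")
  case True then show ?thesis by (simp add: containment_prob_empty[OF c(1) I] containment_prob_empty[OF c(2) I])
next
  case False
  obtain a b :: 'w where ab: "a \<noteq> b"
    using ex_two_points[OF assms(1)] by blast
  have "mi_functional c (uniform_count_measure {a, b}) I (copied_bit a K) =
        mi_functional c' (uniform_count_measure {a, b}) I (copied_bit a K)"
    using agree is_system_copied_bit[OF assms(2) I, of a b K] unfolding agree_def by blast
  then show ?thesis
    by (simp add: mi_functional_copied_bit[OF ab c(1) I K False]
        mi_functional_copied_bit[OF ab c(2) I K False])
qed

lemma exchangeable_imp_containment_prob_eq:
  assumes "infinite (UNIV :: 'w set)" "d \<ge> 2" and c: "coefficient_system c"
    and exch: "exchangeable d (mi_functional c :: 'w functional)"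
    and I: "I \<in> Fpow {1..}" "J \<in> Fpow {1..}" and \<phi>: "bij_betw \<phi> I J" and K: "K \<subseteq> I"
  shows "containment_prob c J (\<phi> ` K) = containment_prob c I K"
proof (cases "K = {}")
  case True then show ?thesis by (simp add: containment_prob_empty[OF c I(1)] containment_prob_empty[OF c I(2)])
next
  case False
  obtain a b :: 'w where ab: "a \<noteq> b"
    using ex_two_points[OF assms(1)] by blast
  let ?M = "uniform_count_measure {a, b}"
  have \<phi>K: "\<phi> ` K \<subseteq> J" "\<phi> ` K \<noteq> {}" using \<phi> K False by (auto simp: bij_betw_def)
  have "mi_functional c ?M I (copied_bit a K) = mi_functional c ?M J (\<lambda>j. copied_bit a K (inv_into I \<phi> j))"
    using exch is_system_copied_bit[OF assms(2) I(1), of a b K] I(2) \<phi>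
    unfolding exchangeable_def by blast
  also have "\<dots> = mi_functional c ?M J (copied_bit a (\<phi> ` K))"
    using \<phi> K by (intro mi_functional_cong)
      (auto simp: copied_bit_def fun_eq_iff bij_betw_def inj_on_eq_iff subset_iff inv_into_f_f)
  finally show ?thesis
    by (simp add: mi_functional_copied_bit[OF ab c I(1) K False]
        mi_functional_copied_bit[OF ab c I(2) \<phi>K])
qed

lemma measurable_subsystem:
  assumes X: "is_system d M I X"
  shows "subsystem X I \<in> M \<rightarrow>\<^sub>M count_space (I \<rightarrow>\<^sub>E {0..<d})"
proof -
  have s: "simple_function M (subsystem X I)"
    using simple_function_subsystem[OF X] by simp
  have "subsystem X I \<omega> \<in> I \<rightarrow>\<^sub>E {0..<d}" if "\<omega> \<in> space M" for \<omega>
    using X that by (auto simp: subsystem_def is_system_def dest!: bspec measurable_space)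
  moreover have "subsystem X I -` A \<inter> space M \<in> sets M" for A
    using s by (simp add: simple_functionD(2))
  ultimately show ?thesis by (auto simp: measurable_def)
qed

lemma independent_of_constant_system:
  assumes X: "is_system d M I X" and Y: "is_system d M J Y" and const: "\<And>\<omega>. subsystem Y J \<omega> = y"
  shows "independent_systems d M I X J Y"
proof -
  interpret prob_space M using X by (simp add: is_system_def)
  let ?SX = "count_space (I \<rightarrow>\<^sub>E {0..<d})" and ?SY = "count_space (J \<rightarrow>\<^sub>E {0..<d})"
  have Xm: "subsystem X I \<in> M \<rightarrow>\<^sub>M ?SX" and Ym: "subsystem Y J \<in> M \<rightarrow>\<^sub>M ?SY"
    using X Y by (auto intro!: measurable_subsystem)
  have Yc: "subsystem Y J = (\<lambda>_. y)" using const by (rule ext)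
  show ?thesis
    unfolding independent_systems_def indep_var_def indep_vars_def2
  proof (intro conjI ballI, goal_cases)
    case (1 i)
    show ?case using Xm Ym by (cases i) auto
  next
    case 2
    let ?E = "\<lambda>X S. {X -` A \<inter> space M |A. A \<in> sets S}"
    have "indep_set (?E (subsystem X I) ?SX) (?E (subsystem Y J) ?SY)"
      using measurable_sets[OF Xm] measurable_sets[OF Ym]
      by (intro indep_setI) (auto simp: Yc prob_space vimage_const split: if_splits)
    also have "?this \<longleftrightarrow> ?case"
      unfolding indep_set_def by (intro indep_sets_cong) (auto split: bool.split)
    finally show ?case .
  qed
qed

text \<open>A bit copied onto \<open>K\<close> is, as a system on \<open>I\<close>, the join of the same system on \<open>K\<close> with constants on
  \<open>I - K\<close>. The constants are independent of everything and have value zero, so the functional has the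
  same value on \<open>I\<close> as on \<open>K\<close>, and \<open>K\<close> is the only subset of \<open>K\<close> that contains \<open>K\<close>.\<close>

lemma weakly_additive_imp_containment_prob_eq:
  assumes "infinite (UNIV :: 'w set)" "d \<ge> 2" and c: "coefficient_system c"
    and add: "weakly_additive d (mi_functional c :: 'w functional)"
    and I: "I \<in> Fpow {1..}" and K: "K \<subseteq> I"
  shows "containment_prob c I K = c K K"
proof (cases "K = {}")
  case True
  then show ?thesis
    using containment_prob_empty[OF c I] containment_prob_empty[OF c, of "{}"]
    by (simp add: containment_prob_self Fpow_def)
next
  case False
  obtain a b :: 'w where ab: "a \<noteq> b"
    using ex_two_points[OF assms(1)] by blast
  let ?M = "uniform_count_measure {a, b}"
  have KJ: "K \<in> Fpow {1..}" "I - K \<in> Fpow {1..}" using I K by (auto simp: Fpow_def intro: finite_subset)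
  note X = is_system_copied_bit[OF assms(2) KJ(1), of a b K]
  note Y = is_system_copied_bit[OF assms(2) KJ(2), of a b "{}"]
  have const: "subsystem (copied_bit a {}) (I - K) \<omega> = (\<lambda>i\<in>I - K. 0)" for \<omega> :: 'w
    by (auto simp: subsystem_def copied_bit_def)
  have "mi_functional c ?M (K \<union> (I - K)) (join K (copied_bit a K) (copied_bit a {})) =
        mi_functional c ?M K (copied_bit a K) + mi_functional c ?M (I - K) (copied_bit a {})"
    using add X Y independent_of_constant_system[OF X Y const] unfolding weakly_additive_def by blast
  moreover have "mi_functional c ?M (I - K) (copied_bit a {}) = 0"
    by (simp add: mi_functional_eq_sum_H[OF c Y] H_copied_bit[OF ab KJ(2)] sum.neutral)
  moreover have "mi_functional c ?M (K \<union> (I - K)) (join K (copied_bit a K) (copied_bit a {})) =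
                 mi_functional c ?M I (copied_bit a K)"
    using K by (simp add: Un_absorb1) (intro mi_functional_cong, auto simp: join_def copied_bit_def)
  ultimately show ?thesis
    by (simp add: mi_functional_copied_bit[OF ab c I K False]
        mi_functional_copied_bit[OF ab c KJ(1) subset_refl False] containment_prob_self)
qed

section \<open>Probability measures on the unit interval\<close>

text \<open>The law of the set of successes among coins indexed by \<open>I\<close> that are independent given their
  common bias, which has law \<open>\<mu>\<close>.\<close>

definition bernoulli_mixture :: "real measure \<Rightarrow> nat set \<Rightarrow> nat set \<Rightarrow> real" where
  "bernoulli_mixture \<mu> I S = (\<integral>x. x ^ card S * (1 - x) ^ (card I - card S) \<partial>\<mu>)"

locale unit_interval_prob = prob_space \<mu> for \<mu> :: "real measure" +
  assumes sets_eq: "sets \<mu> = sets (restrict_space borel {0..1})"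
begin

lemma space_eq: "space \<mu> = {0..1}"
  using sets_eq_imp_space_eq[OF sets_eq] by (simp add: space_restrict_space)

lemma borel_measurableI: "f \<in> borel_measurable borel \<Longrightarrow> f \<in> borel_measurable \<mu>"
  using measurable_restrict_space1[of f borel borel "{0..1}"] measurable_cong_sets[OF sets_eq refl]
  by blast

lemma integrable_bounded:
  fixes f :: "real \<Rightarrow> real"
  assumes "f \<in> borel_measurable borel" "\<And>x. x \<in> {0..1} \<Longrightarrow> \<bar>f x\<bar> \<le> B"
  shows "integrable \<mu> f"
  using assms by (intro integrable_const_bound[where B = B] borel_measurableI) (auto simp: space_eq)

lemma integrable_powers: "integrable \<mu> (\<lambda>x. x ^ s * (1 - x) ^ t)"
  by (rule integrable_bounded[where B = 1])
     (auto simp: abs_mult power_abs intro!: mult_le_one power_le_one)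

lemma integral_powers_nonneg: "0 \<le> (\<integral>x. x ^ s * (1 - x) ^ t \<partial>\<mu>)"
  by (intro integral_nonneg_AE AE_I2) (auto simp: space_eq)

text \<open>Under the integral, the inclusion of each further site is a coin flip with bias \<open>x\<close>; summing
  over all outcomes of these flips gives one.\<close>

lemma sum_Pow_integral_powers:
  assumes J: "finite J"
  shows "(\<Sum>T\<in>Pow J. \<integral>x. x ^ (s + card T) * (1 - x) ^ (t + (card J - card T)) \<partial>\<mu>) =
         (\<integral>x. x ^ s * (1 - x) ^ t \<partial>\<mu>)"
proof -
  have bin: "(\<Sum>T\<in>Pow J. x ^ card T * (1 - x) ^ (card J - card T)) = 1" for x :: real
  proof -
    have "(\<Prod>j\<in>J. x + (1 - x)) = (\<Sum>T\<in>Pow J. x ^ card T * (1 - x) ^ card (J - T))"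
      using prod_add[OF J, of "\<lambda>_. x" "\<lambda>_. 1 - x"] by (simp only: prod_constant)
    also have "\<dots> = (\<Sum>T\<in>Pow J. x ^ card T * (1 - x) ^ (card J - card T))"
      using J by (intro sum.cong refl) (auto simp: card_Diff_subset finite_subset)
    finally show ?thesis by simp
  qed
  have "(\<Sum>T\<in>Pow J. \<integral>x. x ^ (s + card T) * (1 - x) ^ (t + (card J - card T)) \<partial>\<mu>) =
        (\<integral>x. (\<Sum>T\<in>Pow J. x ^ (s + card T) * (1 - x) ^ (t + (card J - card T))) \<partial>\<mu>)"
    by (intro Bochner_Integration.integral_sum[symmetric] integrable_powers)
  also have "(\<lambda>x::real. \<Sum>T\<in>Pow J. x ^ (s + card T) * (1 - x) ^ (t + (card J - card T))) =
             (\<lambda>x. x ^ s * (1 - x) ^ t * (\<Sum>T\<in>Pow J. x ^ card T * (1 - x) ^ (card J - card T)))"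
    by (simp add: sum_distrib_left power_add mult_ac)
  finally show ?thesis by (simp add: bin)
qed

lemma bernoulli_mixture_marginal:
  assumes fin: "finite I" "finite J" and IJ: "I \<inter> J = {}" and S: "S \<subseteq> I"
  shows "(\<Sum>T\<in>Pow J. bernoulli_mixture \<mu> (I \<union> J) (S \<union> T)) = bernoulli_mixture \<mu> I S"
proof -
  have "bernoulli_mixture \<mu> (I \<union> J) (S \<union> T) =
        (\<integral>x. x ^ (card S + card T) * (1 - x) ^ ((card I - card S) + (card J - card T)) \<partial>\<mu>)"
    if T: "T \<subseteq> J" for T
  proof -
    have "card (S \<union> T) = card S + card T" "card (I \<union> J) = card I + card J"
      using S T IJ fin by (auto intro!: card_Un_disjoint intro: finite_subset)
    moreover have "card S \<le> card I" "card T \<le> card J" using S T fin by (auto intro: card_mono)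
    ultimately show ?thesis by (simp add: bernoulli_mixture_def)
  qed
  then have "(\<Sum>T\<in>Pow J. bernoulli_mixture \<mu> (I \<union> J) (S \<union> T)) = (\<Sum>T\<in>Pow J.
    (\<integral>x. x ^ (card S + card T) * (1 - x) ^ ((card I - card S) + (card J - card T)) \<partial>\<mu>))"
    by (intro sum.cong) auto
  also have "\<dots> = bernoulli_mixture \<mu> I S"
    by (simp add: sum_Pow_integral_powers[OF fin(2)] bernoulli_mixture_def)
  finally show ?thesis .
qed

lemma containment_prob_bernoulli_mixture:
  assumes I: "finite I" and K: "K \<subseteq> I"
  shows "containment_prob (bernoulli_mixture \<mu>) I K = (\<integral>x. x ^ card K \<partial>\<mu>)"
proof -
  have "containment_prob (bernoulli_mixture \<mu>) I K =
        (\<Sum>T\<in>Pow (I - K). bernoulli_mixture \<mu> (K \<union> (I - K)) (K \<union> T))"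
    unfolding containment_prob_def using K
    by (intro sum.reindex_bij_witness[of _ "\<lambda>T. K \<union> T" "\<lambda>S. S - K"]) (auto simp: Un_absorb1)
  also have "\<dots> = bernoulli_mixture \<mu> K K"
    using I K by (intro bernoulli_mixture_marginal) (auto intro: finite_subset)
  finally show ?thesis by (simp add: bernoulli_mixture_def)
qed

lemma real_distribution_distr_id: "real_distribution (distr \<mu> borel (\<lambda>x. x))"
  by (intro real_distribution_distr borel_measurableI) simp

lemma measurable_reflection: "(\<lambda>x. 1 - x) \<in> \<mu> \<rightarrow>\<^sub>M \<mu>"
proof -
  have "(\<lambda>x. 1 - x) \<in> \<mu> \<rightarrow>\<^sub>M restrict_space borel {0..1::real}"
    by (intro measurable_restrict_space2 borel_measurableI) (auto simp: space_eq)
  then show ?thesis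
    using measurable_cong_sets[OF refl sets_eq] by blast
qed

lemma distr_reflection: "unit_interval_prob (distr \<mu> \<mu> (\<lambda>x. 1 - x))"
  using measurable_reflection
  by (simp add: unit_interval_prob_def unit_interval_prob_axioms_def prob_space_distr sets_eq)

end

text \<open>Moments bounded by one make the Taylor polynomials of the characteristic function converge to
  it, so the moments determine the characteristic function.\<close>

lemma moments_determine_measure:
  assumes \<mu>: "unit_interval_prob \<mu>" and \<nu>: "unit_interval_prob \<nu>"
    and moments: "\<And>k. (\<integral>x. x ^ k \<partial>\<mu>) = (\<integral>x. x ^ k \<partial>\<nu>)"
  shows "\<mu> = \<nu>"
proof -
  let ?D = "\<lambda>\<mu>. distr \<mu> borel (\<lambda>x::real. x)"
  define P where "P n t = (\<Sum>k\<le>n. ((\<i> * t) ^ k / fact k) * (\<integral>x. x ^ k \<partial>\<mu>))" for n and t :: real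
  \<comment> \<open>\<open>P n t\<close> uses the moments of \<open>\<mu>\<close>, which by assumption are also those of \<open>\<nu>\<close>.\<close>
  have approx: "cmod (char (?D \<kappa>) t - P n t) \<le> 2 * \<bar>t\<bar> ^ n / fact n"
    if "unit_interval_prob \<kappa>" and eq: "\<And>k. (\<integral>x. x ^ k \<partial>\<kappa>) = (\<integral>x. x ^ k \<partial>\<mu>)" for \<kappa> t n
  proof -
    interpret unit_interval_prob \<kappa> by fact
    have int: "integrable \<kappa> (\<lambda>x. x ^ k)" "integrable \<kappa> (\<lambda>x. \<bar>x\<bar> ^ k)" for k
      by (rule integrable_bounded[where B = 1]; auto simp: power_abs intro!: power_le_one)+
    have "cmod (char (?D \<kappa>) t - P n t) \<le> (2 * \<bar>t\<bar> ^ n / fact n) * expectation (\<lambda>x. \<bar>x\<bar> ^ n)"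
      unfolding P_def eq[symmetric]
      by (intro char_approx1' int borel_measurableI refl) simp
    also have "\<dots> \<le> (2 * \<bar>t\<bar> ^ n / fact n) * 1"
    proof (rule mult_left_mono)
      show "expectation (\<lambda>x. \<bar>x\<bar> ^ n) \<le> 1"
        by (intro integral_le_const int AE_I2) (auto simp: space_eq intro!: power_le_one)
    qed simp
    finally show ?thesis by simp
  qed
  have "char (?D \<mu>) = char (?D \<nu>)"
  proof
    fix t :: real
    have "(\<lambda>n. 4 * (\<bar>t\<bar> ^ n / fact n)) \<longlonglongrightarrow> 4 * 0"
      using summable_LIMSEQ_zero[OF summable_exp[of "\<bar>t\<bar>"]]
      by (intro tendsto_mult tendsto_const) (simp add: field_simps)
    moreover have "cmod (char (?D \<mu>) t - char (?D \<nu>) t) \<le> 4 * (\<bar>t\<bar> ^ n / fact n)" for n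
      using approx[OF \<mu> refl, of t n] approx[OF \<nu> moments[symmetric], of t n]
        norm_triangle_ineq4[of "char (?D \<mu>) t - P n t" "char (?D \<nu>) t - P n t"] by simp
    ultimately have "cmod (char (?D \<mu>) t - char (?D \<nu>) t) \<le> 4 * 0"
      by (intro LIMSEQ_le_const) auto
    then show "char (?D \<mu>) t = char (?D \<nu>) t" by simp
  qed
  then have D: "?D \<mu> = ?D \<nu>"
    by (intro Levy_uniqueness unit_interval_prob.real_distribution_distr_id \<mu> \<nu>)
  interpret \<mu>: unit_interval_prob \<mu> by fact
  interpret \<nu>: unit_interval_prob \<nu> by fact
  show ?thesis
  proof (rule measure_eqI)
    show "sets \<mu> = sets \<nu>" by (simp add: \<mu>.sets_eq \<nu>.sets_eq)
    fix A assume "A \<in> sets \<mu>"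
    then have A: "A \<in> sets borel" "A \<subseteq> {0..1}"
      by (auto simp: \<mu>.sets_eq sets_restrict_space)
    have "emeasure (?D \<kappa>) A = emeasure \<kappa> A" if "unit_interval_prob \<kappa>" for \<kappa>
    proof -
      interpret unit_interval_prob \<kappa> by fact
      have "(\<lambda>x. x) -` A \<inter> space \<kappa> = A" using A(2) by (auto simp: space_eq)
      then show ?thesis
        using emeasure_distr[OF borel_measurableI A(1), of "\<lambda>x. x"] by simp
    qed
    from this[OF \<mu>] this[OF \<nu>] show "emeasure \<mu> A = emeasure \<nu> A" by (simp only: D)
  qed
qed

text \<open>The reflected measure has the same moments, hence equals \<open>\<mu>\<close>; this transfers the symmetry from
  monomials to all measurable functions.\<close>

lemma symmetric_prob_if_moments:
  assumes \<mu>: "unit_interval_prob \<mu>"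
    and moments: "\<And>k. (\<integral>x. x ^ k \<partial>\<mu>) = (\<integral>x. (1 - x) ^ k \<partial>\<mu>)"
  shows "symmetric_prob \<mu>"
proof -
  interpret unit_interval_prob \<mu> by fact
  note refl_meas = measurable_reflection
  have "distr \<mu> \<mu> (\<lambda>x. 1 - x) = \<mu>"
    by (rule moments_determine_measure[OF distr_reflection \<mu>])
       (simp add: integral_distr[OF refl_meas] borel_measurableI moments)
  then have "(\<integral>x. f x \<partial>\<mu>) = (\<integral>x. f (1 - x) \<partial>\<mu>)" if "f \<in> borel_measurable \<mu>" for f :: "real \<Rightarrow> real"
    using integral_distr[OF refl_meas that] by simp
  then show ?thesis
    unfolding symmetric_prob_def using sets_eq prob_space_axioms by blast
qed

lemma symmetric_probD: "symmetric_prob \<mu> \<Longrightarrow> unit_interval_prob \<mu>"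
  by (simp add: symmetric_prob_def unit_interval_prob_def unit_interval_prob_axioms_def)

lemma symmetric_prob_integral_powers:
  assumes "symmetric_prob \<mu>"
  shows "(\<integral>x. x ^ s * (1 - x) ^ t \<partial>\<mu>) = (\<integral>x. x ^ t * (1 - x) ^ s \<partial>\<mu>)"
proof -
  interpret unit_interval_prob \<mu> using assms by (rule symmetric_probD)
  let ?f = "\<lambda>x::real. x ^ s * (1 - x) ^ t"
  have "bounded (?f ` {0..1})"
    by (intro compact_imp_bounded compact_continuous_image continuous_intros compact_Icc)
  moreover have "?f \<in> borel_measurable \<mu>" by (intro borel_measurableI) simp
  ultimately have "(\<integral>x. ?f x \<partial>\<mu>) = (\<integral>x. ?f (1 - x) \<partial>\<mu>)"
    using assms unfolding symmetric_prob_def by blast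
  then show ?thesis by (simp add: mult.commute)
qed

section \<open>A representing measure makes the functional an intricacy\<close>

lemma representsD:
  assumes "represents \<mu> c" "I \<in> Fpow {1..}" "S \<subseteq> I"
  shows "c I S = bernoulli_mixture \<mu> I S"
  using assms by (auto simp: represents_def bernoulli_mixture_def)

lemma represents_unit_interval_prob: "represents \<mu> c \<Longrightarrow> unit_interval_prob \<mu>"
  by (simp add: represents_def symmetric_probD)

lemma represents_imp_coefficient_system:
  assumes rep: "represents \<mu> c"
  shows "coefficient_system c"
proof -
  interpret unit_interval_prob \<mu> using rep by (rule represents_unit_interval_prob)
  have sym: "symmetric_prob \<mu>" using rep by (simp add: represents_def)
  show ?thesis
    unfolding coefficient_system_def
  proof (intro ballI allI impI conjI)
    fix I :: "nat set" and S assume I: "I \<in> Fpow {1..}" and S: "S \<subseteq> I"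
    have fin: "finite I" using I by (simp add: Fpow_def)
    show "0 \<le> c I S"
      unfolding representsD[OF rep I S] bernoulli_mixture_def by (rule integral_powers_nonneg)
    have "card (I - S) = card I - card S" "card S \<le> card I"
      using fin S by (auto simp: card_Diff_subset finite_subset card_mono)
    then show "c I (I - S) = c I S"
      using symmetric_prob_integral_powers[OF sym, of "card I - card S" "card S"]
      by (simp add: representsD[OF rep I S] representsD[OF rep I Diff_subset] bernoulli_mixture_def)
  next
    fix I :: "nat set" assume I: "I \<in> Fpow {1..}"
    then have fin: "finite I" by (simp add: Fpow_def)
    show "(\<Sum>S\<in>Pow I. c I S) = 1"
      using sum_Pow_integral_powers[OF fin, of 0 0] prob_space
      by (simp add: representsD[OF rep I] bernoulli_mixture_def)
  qed
qed

text \<open>The coefficients of a mixture depend on cardinalities only and are consistent under marginalisation.\<close>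

lemma represents_imp_intricacy:
  assumes rep: "represents \<mu> c"
  shows "exchangeable d (mi_functional c)" and "weakly_additive d (mi_functional c)"
    and "intricacy d (mi_functional c)"
proof -
  have c: "coefficient_system c" using rep by (rule represents_imp_coefficient_system)
  show e: "exchangeable d (mi_functional c)"
  proof (rule exchangeable_if_coefficients[OF c])
    fix I J :: "nat set" and \<phi> S
    assume IJ: "I \<in> Fpow {1..}" "J \<in> Fpow {1..}" and \<phi>: "bij_betw \<phi> I J" and S: "S \<subseteq> I"
    have "card (\<phi> ` S) = card S" "card J = card I" "\<phi> ` S \<subseteq> J"
      using \<phi> S bij_betw_same_card[OF \<phi>]
      by (auto simp: bij_betw_def intro!: card_image intro: inj_on_subset)
    then show "c J (\<phi> ` S) = c I S"
      by (simp add: representsD[OF rep IJ(1) S] representsD[OF rep IJ(2)] bernoulli_mixture_def)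
  qed
  show w: "weakly_additive d (mi_functional c)"
  proof (rule weakly_additive_if_coefficients[OF c])
    fix I J S :: "nat set"
    assume IJ: "I \<in> Fpow {1..}" "J \<in> Fpow {1..}" "I \<inter> J = {}" and S: "S \<subseteq> I"
    have "I \<union> J \<in> Fpow {1..}" using IJ by (auto simp: Fpow_def)
    note c_IJ = representsD[OF rep this]
    have "(\<Sum>T\<in>Pow J. c (I \<union> J) (S \<union> T)) = (\<Sum>T\<in>Pow J. bernoulli_mixture \<mu> (I \<union> J) (S \<union> T))"
      using S by (intro sum.cong refl c_IJ) auto
    also have "\<dots> = bernoulli_mixture \<mu> I S"
      using IJ S
      by (intro unit_interval_prob.bernoulli_mixture_marginal represents_unit_interval_prob[OF rep])
         (auto simp: Fpow_def)
    finally show "(\<Sum>T\<in>Pow J. c (I \<union> J) (S \<union> T)) = c I S"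
      by (simp add: representsD[OF rep IJ(1) S])
  qed
  show "intricacy d (mi_functional c)"
    using c e w unfolding intricacy_def by (auto simp: agree_def)
qed

lemma containment_prob_cong:
  "(\<And>S. S \<subseteq> I \<Longrightarrow> c I S = c' I S) \<Longrightarrow> containment_prob c I K = containment_prob c' I K"
  unfolding containment_prob_def by (intro sum.cong) auto

lemma represents_containment_prob:
  assumes rep: "represents \<mu> c" and I: "I \<in> Fpow {1..}" and K: "K \<subseteq> I"
  shows "containment_prob c I K = (\<integral>x. x ^ card K \<partial>\<mu>)"
  using containment_prob_cong[of I c "bernoulli_mixture \<mu>" K, OF representsD[OF rep I]] I
    unit_interval_prob.containment_prob_bernoulli_mixture[OF represents_unit_interval_prob[OF rep] _ K]
  by (simp add: Fpow_def)

section \<open>Containment probabilities are moments\<close>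

lemma fact_times_binomial: "fact k * real (n choose k) = (\<Prod>i<k. real n - real i)"
  by (simp add: binomial_gbinomial gbinomial_prod_rev atLeast0LessThan)

text \<open>The ratio is the probability that \<open>k\<close> draws without replacement from \<open>n\<close> objects all hit a given set of
  \<open>j\<close> objects, and the power is the same probability with replacement. The two differ by a factor
  \<open>(j - i) / (n - i)\<close> in place of \<open>j / n\<close> in the draw after \<open>i\<close> others, and these errors add up.\<close>

lemma abs_binomial_ratio_diff_le:
  assumes "j \<le> n" "k \<le> n" "0 < n"
  shows "\<bar>real (j choose k) / real (n choose k) - (real j / real n) ^ k\<bar> \<le>
         (\<Sum>i<k. real i / (real n - real i))"
  using \<open>k \<le> n\<close>
proof (induction k)
  case (Suc k)
  then have k: "k < n" "k \<le> n" by auto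
  let ?r = "\<lambda>k. real (j choose k) / real (n choose k)" and ?p = "real j / real n"
  let ?a = "(real j - real k) / (real n - real k)"
  have ratio: "?r k = (\<Prod>i<k. real j - real i) / (\<Prod>i<k. real n - real i)" for k
    unfolding fact_times_binomial[symmetric] by simp
  then have r_Suc: "?r (Suc k) = ?r k * ?a"
    by simp
  have r_le: "\<bar>?r k\<bar> \<le> 1"
    using binomial_right_mono[OF \<open>j \<le> n\<close>, of k] k by (simp add: divide_le_eq_1)
  have "?a - ?p = - (real k * (real n - real j)) / (real n * (real n - real k))"
    using k \<open>0 < n\<close> by (simp add: field_simps)
  then have "\<bar>?a - ?p\<bar> = (real k / (real n - real k)) * ((real n - real j) / real n)"
    using k \<open>0 < n\<close> \<open>j \<le> n\<close> by (simp add: abs_mult)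
  also have "\<dots> \<le> (real k / (real n - real k)) * 1"
    using k \<open>0 < n\<close> \<open>j \<le> n\<close> by (intro mult_left_mono) auto
  finally have a_le: "\<bar>?a - ?p\<bar> \<le> real k / (real n - real k)" by simp
  \<comment> \<open>Replace one factor at a time.\<close>
  have "?r (Suc k) - ?p ^ Suc k = ?r k * (?a - ?p) + ?p * (?r k - ?p ^ k)"
    by (simp add: r_Suc algebra_simps del: times_divide_eq_left times_divide_eq_right)
  also have "\<bar>\<dots>\<bar> \<le> \<bar>?r k\<bar> * \<bar>?a - ?p\<bar> + \<bar>?p\<bar> * \<bar>?r k - ?p ^ k\<bar>"
    by (rule order_trans[OF abs_triangle_ineq]) (simp only: abs_mult order_refl)
  also have "\<dots> \<le> 1 * \<bar>?a - ?p\<bar> + 1 * \<bar>?r k - ?p ^ k\<bar>"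
    using \<open>j \<le> n\<close> \<open>0 < n\<close> by (intro add_mono mult_right_mono r_le) auto
  also have "\<dots> \<le> real k / (real n - real k) + (\<Sum>i<k. real i / (real n - real i))"
    using a_le Suc.IH[OF k(2)] by simp
  finally show ?case by simp
qed simp

text \<open>Both sides are the expected number of \<open>k\<close>-element subsets of the random set: the right side adds up, over
  all \<open>k\<close>-element subsets of \<open>I\<close>, the probability of being contained in it.\<close>

lemma sum_binomial_card:
  assumes I: "finite I" and m: "\<And>K. K \<subseteq> I \<Longrightarrow> containment_prob c I K = m (card K)"
  shows "(\<Sum>S\<in>Pow I. c I S * real (card S choose k)) = real (card I choose k) * m k"
proof -
  let ?P = "{K \<in> Pow I. card K = k}"
  have "real (card S choose k) = (\<Sum>K\<in>?P. if K \<subseteq> S then 1 else 0)" if S: "S \<subseteq> I" for S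
  proof -
    have "?P \<inter> {K. K \<subseteq> S} = {K. K \<subseteq> S \<and> card K = k}" using S by auto
    then show ?thesis using I n_subsets[OF finite_subset[OF S I], of k]
      by (simp add: sum.If_cases)
  qed
  then have "(\<Sum>S\<in>Pow I. c I S * real (card S choose k)) =
             (\<Sum>S\<in>Pow I. \<Sum>K\<in>?P. if K \<subseteq> S then c I S else 0)"
    by (intro sum.cong refl) (auto simp: sum_distrib_left intro!: sum.cong)
  also have "\<dots> = (\<Sum>K\<in>?P. \<Sum>S\<in>Pow I. if K \<subseteq> S then c I S else 0)"
    by (rule sum.swap)
  also have "\<dots> = (\<Sum>K\<in>?P. containment_prob c I K)"
    by (simp add: containment_prob_eq_sum_if[OF I])
  also have "\<dots> = real (card ?P) * m k"
    by (simp add: m)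
  also have "?P = {K. K \<subseteq> I \<and> card K = k}" by auto
  finally show ?thesis by (simp add: n_subsets[OF I])
qed

text \<open>Laws on \<open>[0,1]\<close> are tight, so some subsequence converges weakly, and polynomials are bounded and
  continuous once their argument is clamped to \<open>[0,1]\<close>. Pushing the limit forward under the clamping map
  gives a measure on \<open>[0,1]\<close> with these limits as moments.\<close>

lemma moment_limits_have_measure:
  assumes rd: "\<And>n. real_distribution (\<nu> n)" and unit: "\<And>n. AE x in \<nu> n. x \<in> {0..1}"
    and lim: "\<And>k. (\<lambda>n. \<integral>x. x ^ k \<partial>\<nu> n) \<longlonglongrightarrow> m k"
  shows "\<exists>\<mu>. unit_interval_prob \<mu> \<and> (\<forall>k. (\<integral>x. x ^ k \<partial>\<mu>) = m k)"
proof -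
  have "measure (\<nu> n) {-1<..2} = 1" for n
  proof -
    interpret real_distribution "\<nu> n" by (rule rd)
    show ?thesis using unit[of n] by (intro prob_eq_1[THEN iffD2]) auto
  qed
  then have "(-1::real) < 2 \<and> (\<forall>n. measure (\<nu> n) {-1<..2} > 1 - \<epsilon>)" if "0 < \<epsilon>" for \<epsilon> :: real
    using that by simp
  then have "tight \<nu>"
    unfolding tight_def using rd by blast
  from tight_imp_convergent_subsubsequence[OF this strict_mono_id]
  obtain r M where r: "strict_mono r" and M: "real_distribution M" and wc: "weak_conv_m (\<nu> \<circ> r) M"
    by auto
  interpret M: real_distribution M by fact
  define clamp :: "real \<Rightarrow> real" where "clamp x = max 0 (min 1 x)" for x
  have clamp01: "clamp x \<in> {0..1}" and clamp_id: "x \<in> {0..1} \<Longrightarrow> clamp x = x" for x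
    by (auto simp: clamp_def)
  have cont: "continuous_on UNIV clamp"
    unfolding clamp_def by (intro continuous_intros)
  let ?R = "restrict_space borel {0..1::real}"
  let ?\<mu> = "distr M ?R clamp"
  have meas: "clamp \<in> borel \<rightarrow>\<^sub>M ?R"
    using cont clamp01 by (intro measurable_restrict_space2 borel_measurable_continuous_onI) auto
  then have measM: "clamp \<in> M \<rightarrow>\<^sub>M ?R" by simp
  have "unit_interval_prob ?\<mu>"
    using M.prob_space_distr[OF measM] by (simp add: unit_interval_prob_def unit_interval_prob_axioms_def)
  moreover have "(\<integral>x. x ^ k \<partial>?\<mu>) = m k" for k
  proof -
    have mclamp: "(\<lambda>x. clamp x ^ k) \<in> borel_measurable borel"
      using cont by (intro borel_measurable_continuous_onI continuous_intros)
    have "(\<integral>x. x ^ k \<partial>?\<mu>) = (\<integral>x. clamp x ^ k \<partial>M)"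
      by (intro integral_distr measM measurable_restrict_space1) simp
    moreover have "(\<lambda>n. \<integral>x. clamp x ^ k \<partial>((\<nu> \<circ> r) n)) \<longlonglongrightarrow> (\<integral>x. clamp x ^ k \<partial>M)"
    proof (rule weak_conv_imp_integral_bdd_continuous_conv[where B = 1])
      show "isCont (\<lambda>x. clamp x ^ k) x" for x
        using cont by (intro continuous_intros) (simp add: continuous_on_eq_continuous_at)
      show "norm (clamp x ^ k) \<le> 1" for x
        using clamp01[of x] by (simp add: power_abs power_le_one)
    qed (use rd M wc in \<open>auto simp: comp_def\<close>)
    moreover have "(\<integral>x. clamp x ^ k \<partial>((\<nu> \<circ> r) n)) = (\<integral>x. x ^ k \<partial>\<nu> (r n))" for n
    proof -
      interpret real_distribution "\<nu> (r n)" by (rule rd)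
      show ?thesis
        using unit[of "r n"] mclamp unfolding comp_def
        by (intro integral_cong_AE) (auto simp: clamp_id)
    qed
    moreover have "(\<lambda>n. \<integral>x. x ^ k \<partial>\<nu> (r n)) \<longlonglongrightarrow> m k"
      using LIMSEQ_subseq_LIMSEQ[OF lim r] by (simp add: comp_def)
    ultimately show ?thesis
      using LIMSEQ_unique by auto
  qed
  ultimately show ?thesis by blast
qed

text \<open>Both sides have the same containment probabilities, and those determine a law on subsets.\<close>

lemma coefficients_eq_bernoulli_mixture:
  assumes \<mu>: "unit_interval_prob \<mu>" and I: "finite I"
    and eq: "\<And>K. K \<subseteq> I \<Longrightarrow> containment_prob c I K = (\<integral>x. x ^ card K \<partial>\<mu>)" and S: "S \<subseteq> I"
  shows "c I S = bernoulli_mixture \<mu> I S"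
proof (rule eq_if_superset_sums_eq[OF I _ S])
  fix K assume K: "K \<subseteq> I"
  show "(\<Sum>S | K \<subseteq> S \<and> S \<subseteq> I. c I S) = (\<Sum>S | K \<subseteq> S \<and> S \<subseteq> I. bernoulli_mixture \<mu> I S)"
    using eq[OF K] unit_interval_prob.containment_prob_bernoulli_mixture[OF \<mu> I K]
    by (simp add: containment_prob_def)
qed

text \<open>The \<open>k\<close>-th moment of the empirical frequency \<open>|Z \<inter> {1..n}| / n\<close> differs from \<open>m k\<close> only through
  sampling without instead of with replacement, an effect that vanishes as \<open>n\<close> grows. A weak limit
  of the laws of these frequencies therefore has moments \<open>m\<close>.\<close>

lemma containment_moments_have_measure:
  assumes c: "coefficient_system c"
    and m: "\<And>I K. I \<in> Fpow {1..} \<Longrightarrow> K \<subseteq> I \<Longrightarrow> containment_prob c I K = m (card K)"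
  shows "\<exists>\<mu>. unit_interval_prob \<mu> \<and> (\<forall>k. (\<integral>x. x ^ k \<partial>\<mu>) = m k)"
proof (rule moment_limits_have_measure)
  let ?I = "\<lambda>n::nat. {1..n}"
  have I: "?I n \<in> Fpow {1..}" for n by (auto simp: Fpow_def)
  have c_nonneg: "0 \<le> c (?I n) S" if "S \<in> Pow (?I n)" for n S
    using coefficient_systemD(1)[OF c I] that by auto
  let ?Z = "\<lambda>n. point_measure (Pow (?I n)) (c (?I n))"
  let ?freq = "\<lambda>n S. real (card S) / real n"
  define \<nu> where "\<nu> n = distr (?Z n) borel (?freq n)" for n
  have meas: "f \<in> ?Z n \<rightarrow>\<^sub>M N" if "f \<in> Pow (?I n) \<rightarrow> space N" for f n and N :: "real measure"
    using that by (auto simp: measurable_point_measure_eq1)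
  have prob: "prob_space (?Z n)" for n
  proof (rule prob_spaceI)
    show "emeasure (?Z n) (space (?Z n)) = 1"
      using c_nonneg[of _ n] coefficient_systemD(3)[OF c I[of n]]
      by (simp add: space_point_measure emeasure_point_measure_finite sum_ennreal del: Pow_iff)
  qed
  show "real_distribution (\<nu> n)" for n
    unfolding \<nu>_def by (intro prob_space.real_distribution_distr prob meas) auto
  have freq: "?freq n S \<in> {0..1}" if "S \<in> Pow (?I n)" for n S
    using that card_mono[of "?I n" S] by (auto simp: divide_le_eq_1)
  show "AE x in \<nu> n. x \<in> {0..1}" for n
    unfolding \<nu>_def using freq[of _ n]
    by (subst AE_distr_iff) (auto intro!: meas AE_I2 simp: space_point_measure)
  have moment: "(\<integral>x. x ^ k \<partial>\<nu> n) = (\<Sum>S\<in>Pow (?I n). c (?I n) S * ?freq n S ^ k)" for n k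
    unfolding \<nu>_def using c_nonneg[of _ n]
    by (subst integral_distr) (auto intro!: meas simp: lebesgue_integral_point_measure_finite simp del: Pow_iff)
  show "(\<lambda>n. \<integral>x. x ^ k \<partial>\<nu> n) \<longlonglongrightarrow> m k" for k
  proof -
    let ?e = "\<lambda>n. \<Sum>i<k. real i / (real n - real i)"
    have bound: "\<bar>(\<integral>x. x ^ k \<partial>\<nu> n) - m k\<bar> \<le> ?e n" if n: "max 1 k \<le> n" for n
    proof -
      have "m k = (\<Sum>S\<in>Pow (?I n). c (?I n) S * real (card S choose k)) / real (n choose k)"
        using sum_binomial_card[of "?I n" c m k, OF _ m[OF I]] n by simp
      also have "\<dots> = (\<Sum>S\<in>Pow (?I n). c (?I n) S * (real (card S choose k) / real (n choose k)))"
        by (simp add: sum_divide_distrib)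
      finally have "\<bar>(\<integral>x. x ^ k \<partial>\<nu> n) - m k\<bar> = \<bar>\<Sum>S\<in>Pow (?I n). c (?I n) S *
          (?freq n S ^ k - real (card S choose k) / real (n choose k))\<bar>"
        by (simp add: moment right_diff_distrib sum_subtractf)
      also have "\<dots> \<le> (\<Sum>S\<in>Pow (?I n). c (?I n) S * ?e n)"
      proof (rule order_trans[OF sum_abs], rule sum_mono)
        fix S assume S: "S \<in> Pow (?I n)"
        have "card S \<le> n" using S card_mono[of "?I n" S] by simp
        then have "\<bar>?freq n S ^ k - real (card S choose k) / real (n choose k)\<bar> \<le> ?e n"
          using abs_binomial_ratio_diff_le[of "card S" n k] n by (simp add: abs_minus_commute)
        then show "\<bar>c (?I n) S * (?freq n S ^ k - real (card S choose k) / real (n choose k))\<bar>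
                   \<le> c (?I n) S * ?e n"
          using c_nonneg[OF S] by (simp add: abs_mult mult_left_mono)
      qed
      also have "\<dots> = ?e n"
        using coefficient_systemD(3)[OF c I[of n]] by (simp flip: sum_distrib_right)
      finally show ?thesis .
    qed
    have "(\<lambda>n. real i / (real n - real i)) \<longlonglongrightarrow> 0" for i
      by real_asymp
    then have "?e \<longlonglongrightarrow> (\<Sum>i<k. 0)" by (intro tendsto_sum)
    then have e: "?e \<longlonglongrightarrow> 0" by simp
    have "(\<lambda>n. (\<integral>x. x ^ k \<partial>\<nu> n) - m k) \<longlonglongrightarrow> 0"
      by (rule Lim_null_comparison[OF _ e])
         (use bound in \<open>auto simp: eventually_sequentially intro!: exI[of _ "max 1 k"]\<close>)
    then show ?thesis by (rule LIM_zero_cancel)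
  qed
qed

section \<open>Intricacies are represented by exactly one measure\<close>

lemma intricacy_containment_prob_eq:
  assumes "infinite (UNIV :: 'w set)" "d \<ge> 2" and c: "coefficient_system c"
    and F: "intricacy d (mi_functional c :: 'w functional)"
    and I: "I \<in> Fpow {1..}" and K: "K \<subseteq> I"
  shows "containment_prob c I K = c {1..card K} {1..card K}"
proof -
  have exch: "exchangeable d (mi_functional c :: 'w functional)"
    and add: "weakly_additive d (mi_functional c :: 'w functional)"
    using F by (simp_all add: intricacy_def)
  have KF: "K \<in> Fpow {1..}" and JF: "{1..card K} \<in> Fpow {1..}"
    using I K by (auto simp: Fpow_def intro: finite_subset)
  then obtain \<phi> where \<phi>: "bij_betw \<phi> K {1..card K}"
    using ex_bij_betw_nat_finite_1[of K] by (auto simp: Fpow_def dest: bij_betw_inv)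
  have "containment_prob c I K = c K K"
    by (rule weakly_additive_imp_containment_prob_eq[OF assms(1,2) c add I K])
  also have "\<dots> = containment_prob c {1..card K} (\<phi> ` K)"
    using exchangeable_imp_containment_prob_eq[OF assms(1,2) c exch KF JF \<phi> subset_refl]
    by (simp add: containment_prob_self)
  also have "\<phi> ` K = {1..card K}" using \<phi> by (simp add: bij_betw_def)
  finally show ?thesis by (simp add: containment_prob_self)
qed

text \<open>The measure comes from the moments. It is symmetric because \<open>c I {} = c I I\<close> says that \<open>1 - x\<close> and \<open>x\<close>
  have the same moments.\<close>

lemma intricacy_imp_represented:
  assumes "infinite (UNIV :: 'w set)" "d \<ge> 2" and c: "coefficient_system c"
    and F: "intricacy d (mi_functional c :: 'w functional)"
  shows "\<exists>\<mu>. represents \<mu> c"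
proof -
  note cont = intricacy_containment_prob_eq[OF assms]
  from containment_moments_have_measure[of c "\<lambda>k. c {1..k} {1..k}", OF c cont]
  obtain \<mu> where \<mu>: "unit_interval_prob \<mu>" and moments: "\<And>k. (\<integral>x. x ^ k \<partial>\<mu>) = c {1..k} {1..k}"
    by blast
  have eq: "c I S = bernoulli_mixture \<mu> I S" if I: "I \<in> Fpow {1..}" and S: "S \<subseteq> I" for I S
  proof (rule coefficients_eq_bernoulli_mixture[OF \<mu> _ _ S])
    show "finite I" using I by (simp add: Fpow_def)
    show "containment_prob c I K = (\<integral>x. x ^ card K \<partial>\<mu>)" if "K \<subseteq> I" for K
      using cont[OF I that] by (simp only: moments)
  qed
  have "(\<integral>x. x ^ k \<partial>\<mu>) = (\<integral>x. (1 - x) ^ k \<partial>\<mu>)" for k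
  proof -
    have I: "{1..k} \<in> Fpow {1..}" by (auto simp: Fpow_def)
    show ?thesis
      using coefficient_systemD(2)[OF c I subset_refl]
      by (simp add: eq[OF I] bernoulli_mixture_def del: One_nat_def)
  qed
  then have "symmetric_prob \<mu>" by (rule symmetric_prob_if_moments[OF \<mu>])
  then have "represents \<mu> c"
    unfolding represents_def using eq by (simp add: bernoulli_mixture_def)
  then show ?thesis ..
qed

lemma represents_unique:
  assumes rep: "represents \<mu> c" "represents \<mu>' c'"
    and eq: "\<And>I K. I \<in> Fpow {1..} \<Longrightarrow> K \<subseteq> I \<Longrightarrow> containment_prob c I K = containment_prob c' I K"
  shows "\<mu>' = \<mu>"
proof (rule moments_determine_measure[OF rep(2,1)[THEN represents_unit_interval_prob]])
  fix k :: nat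
  have I: "{1..k} \<in> Fpow {1..}" by (auto simp: Fpow_def)
  show "(\<integral>x. x ^ k \<partial>\<mu>') = (\<integral>x. x ^ k \<partial>\<mu>)"
    using eq[OF I subset_refl]
    by (simp add: represents_containment_prob[OF rep(1) I] represents_containment_prob[OF rep(2) I]
        del: One_nat_def)
qed

section \<open>Non-nullity\<close>

lemma (in unit_interval_prob) integral_powers_pos_iff:
  assumes "0 < s" "0 < t"
  shows "0 < (\<integral>x. x ^ s * (1 - x) ^ t \<partial>\<mu>) \<longleftrightarrow> 0 < measure \<mu> {0<..<1}"
proof -
  have A: "{0<..<1} \<in> sets \<mu>" by (auto simp: sets_eq sets_restrict_space_iff)
  have "(\<integral>x. x ^ s * (1 - x) ^ t \<partial>\<mu>) = 0 \<longleftrightarrow> (AE x in \<mu>. x ^ s * (1 - x) ^ t = 0)"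
    by (intro integral_nonneg_eq_0_iff_AE integrable_powers AE_I2) (auto simp: space_eq)
  also have "\<dots> \<longleftrightarrow> (AE x in \<mu>. x \<notin> {0<..<1})"
    using assms by (intro AE_cong) (auto simp: space_eq)
  also have "\<dots> \<longleftrightarrow> measure \<mu> {0<..<1} = 0"
    using prob_eq_0[OF A] by simp
  finally show ?thesis
    using integral_powers_nonneg[of s t] measure_nonneg[of \<mu> "{0<..<1}"] by linarith
qed

lemma represents_pos_iff:
  assumes rep: "represents \<mu> c" and I: "I \<in> Fpow {1..}" and S: "S \<subseteq> I" "S \<noteq> {}" "S \<noteq> I"
  shows "0 < c I S \<longleftrightarrow> 0 < measure \<mu> {0<..<1}"
proof -
  have "finite I" "finite S" using I S by (auto simp: Fpow_def intro: finite_subset)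
  then have "0 < card S" "0 < card I - card S"
    using S by (auto simp: card_gt_0_iff intro!: psubset_card_mono)
  then show ?thesis
    unfolding representsD[OF rep I S(1)] bernoulli_mixture_def
    by (rule unit_interval_prob.integral_powers_pos_iff[OF represents_unit_interval_prob[OF rep]])
qed

lemma represents_non_null_iff:
  assumes rep: "represents \<mu> c"
  shows "non_null c \<longleftrightarrow> 0 < measure \<mu> {0<..<1}"
proof
  assume "non_null c"
  then obtain I S where I: "I \<in> Fpow {1..}" and S: "S \<subseteq> I" "S \<noteq> {}" "S \<noteq> I" and "c I S \<noteq> 0"
    by (auto simp: non_null_def)
  moreover have "0 \<le> c I S"
    using coefficient_systemD(1)[OF represents_imp_coefficient_system[OF rep] I S(1)] .
  ultimately show "0 < measure \<mu> {0<..<1}"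
    using represents_pos_iff[OF rep I S] by simp
next
  assume *: "0 < measure \<mu> {0<..<1}"
  have I: "{1, 2} \<in> Fpow {1 :: nat..}" and S: "{1} \<subseteq> {1, 2 :: nat}" "{1} \<noteq> {1, 2 :: nat}"
    by (auto simp: Fpow_def)
  have "0 < c {1, 2} {1}"
    using represents_pos_iff[OF rep I S(1) _ S(2)] * by simp
  then show "non_null c" unfolding non_null_def using I S by (intro bexI[OF _ I] exI[of _ "{1}"]) auto
qed

section \<open>Lebesgue measure and the neural complexity\<close>

lemma unit_interval_prob_lebesgue01: "unit_interval_prob lebesgue01"
proof -
  have "sets lebesgue01 = sets (restrict_space borel {0..1})"
    by (simp add: lebesgue01_def sets_restrict_space)
  moreover have "prob_space lebesgue01"
    by (rule prob_spaceI) (simp add: lebesgue01_def space_restrict_space emeasure_restrict_space)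
  ultimately show ?thesis
    by (simp add: unit_interval_prob_def unit_interval_prob_axioms_def)
qed

lemma integral_lebesgue01: "(\<integral>x. f x \<partial>lebesgue01) = (\<integral>x. f x * indicator {0..1} x \<partial>lborel)"
  for f :: "real \<Rightarrow> real"
  by (simp add: lebesgue01_def integral_restrict_space mult.commute)

text \<open>The integral of the derivative of \<open>x\<^sup>s\<^sup>+\<^sup>1 * (1 - x)\<^sup>t\<^sup>+\<^sup>1\<close> vanishes, which trades a factor \<open>1 - x\<close> for
  a factor \<open>x\<close>.\<close>

lemma integral_powers_lebesgue01:
  "(\<integral>x. x ^ s * (1 - x) ^ t \<partial>lebesgue01) = fact s * fact t / fact (s + t + 1)"
proof (induction t arbitrary: s)
  case 0
  have "((\<lambda>x. x ^ Suc s / real (Suc s)) has_real_derivative x ^ s) (at x)" for x :: real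
    by (auto intro!: derivative_eq_intros simp del: of_nat_Suc power_Suc)
  then have "(\<integral>x. x ^ s * indicator {0..1} x \<partial>lborel) =
             1 ^ Suc s / real (Suc s) - 0 ^ Suc s / real (Suc s)"
    by (intro integral_FTC_Icc_real) auto
  also have "\<dots> = fact s / fact (Suc s)"
    by (simp del: of_nat_Suc)
  finally show ?case by (simp add: integral_lebesgue01)
next
  case (Suc t)
  interpret unit_interval_prob lebesgue01 by (rule unit_interval_prob_lebesgue01)
  let ?F = "\<lambda>x::real. x ^ Suc s * (1 - x) ^ Suc t"
  have "(\<integral>x. (real (Suc s) * (x ^ s * (1 - x) ^ Suc t) - real (Suc t) * (x ^ Suc s * (1 - x) ^ t))
          * indicator {0..1} x \<partial>lborel) = ?F 1 - ?F 0"
    by (rule integral_FTC_Icc_real)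
       (auto intro!: derivative_eq_intros continuous_intros simp: algebra_simps simp del: power_Suc of_nat_Suc)
  then have "(\<integral>x. real (Suc s) * (x ^ s * (1 - x) ^ Suc t) - real (Suc t) * (x ^ Suc s * (1 - x) ^ t)
          \<partial>lebesgue01) = 0"
    by (simp add: integral_lebesgue01)
  then have "real (Suc s) * (\<integral>x. x ^ s * (1 - x) ^ Suc t \<partial>lebesgue01) =
             real (Suc t) * (\<integral>x. x ^ Suc s * (1 - x) ^ t \<partial>lebesgue01)"
    by (subst (asm) Bochner_Integration.integral_diff)
       (auto intro!: integrable_mult_right integrable_powers simp del: power_Suc of_nat_Suc)
  then show ?case
    unfolding Suc.IH[of "Suc s"] by (simp add: field_simps del: power_Suc of_nat_Suc) 
qed

lemma neural_coeff_eq_integral: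
  assumes "finite I" "S \<subseteq> I"
  shows "neural_coeff I S = (\<integral>x. x ^ card S * (1 - x) ^ (card I - card S) \<partial>lebesgue01)"
proof -
  have "card S \<le> card I" using assms by (auto intro: card_mono)
  then show ?thesis
    by (simp add: integral_powers_lebesgue01 neural_coeff_def binomial_fact field_simps)
qed

lemma represents_neural_coeff: "represents lebesgue01 neural_coeff"
proof -
  have "(\<integral>x. x ^ k \<partial>lebesgue01) = (\<integral>x. (1 - x) ^ k \<partial>lebesgue01)" for k
    using integral_powers_lebesgue01[of k 0] integral_powers_lebesgue01[of 0 k] by simp
  then show ?thesis
    unfolding represents_def
    by (auto intro: symmetric_prob_if_moments unit_interval_prob_lebesgue01
        simp: neural_coeff_eq_integral Fpow_def)
qed

section \<open>Sampling from the mixture\<close>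

lemma emeasure_uniform01:
  assumes "w \<in> {0..1}"
  shows "emeasure (uniform_measure lborel {0..1::real}) {w..} = ennreal (1 - w)"
    and "emeasure (uniform_measure lborel {0..1::real}) {..<w} = ennreal w"
proof -
  have "{0..1} \<inter> {w..} = {w..1}" "{0..1} \<inter> {..<w} = {0..<w}" using assms by auto
  then show "emeasure (uniform_measure lborel {0..1::real}) {w..} = ennreal (1 - w)"
    "emeasure (uniform_measure lborel {0..1::real}) {..<w} = ennreal w"
    using assms by (simp_all add: emeasure_uniform_measure divide_ennreal_def)
qed

text \<open>Independence makes the joint law of \<open>W\<close> and the \<open>Y\<^sub>i\<close> a product measure. By Fubini's theorem, with
  \<open>W = w\<close> fixed the event is a box in the \<open>Y\<^sub>i\<close>, with sides \<open>[w, \<infinity>)\<close> for \<open>i \<in> S\<close> and \<open>(-\<infinity>, w)\<close>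
  otherwise.\<close>

lemma sampling_family_law:
  assumes \<mu>: "unit_interval_prob \<mu>" and fam: "sampling_family \<mu> N W Y"
    and I: "I \<in> Fpow {1..}" and S: "S \<subseteq> I"
  shows "measure N {\<omega> \<in> space N. random_set W Y \<omega> \<inter> I = S} =
         (\<integral>x. (1 - x) ^ card S * x ^ (card I - card S) \<partial>\<mu>)"
proof -
  interpret \<mu>: unit_interval_prob \<mu> by fact
  interpret N: prob_space N using fam by (simp add: sampling_family_def)
  have fin: "finite I" "finite S" and I1: "I \<subseteq> {1..}"
    using I S by (auto simp: Fpow_def intro: finite_subset)
  let ?A = "insert None (Some ` I)" and ?X = "case_option W Y"
  let ?U = "uniform_measure lborel {0..1::real}"
  \<comment> \<open>The law of \<open>Y 0\<close> is unconstrained, so the product measure is built from laws prescribed at every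
    index.\<close>
  define L where "L = case_option (distr \<mu> borel (\<lambda>x. x)) (\<lambda>_::nat. ?U)"
  have "prob_space ?U" by (rule prob_space_uniform_measure) auto
  then have pL: "prob_space (L j)" for j
    using \<mu>.prob_space_distr[OF \<mu>.borel_measurableI, of "\<lambda>x. x"]
    by (auto simp: L_def split: option.split)
  interpret L: product_sigma_finite L
    by (rule product_sigma_finite.intro) (rule prob_space_imp_sigma_finite[OF pL])
  have setsL: "sets (L j) = sets borel" for j
    by (auto simp: L_def split: option.split)
  have id_meas: "(\<lambda>x. x) \<in> borel_measurable \<mu>" by (intro \<mu>.borel_measurableI) simp
  have unit: "AE w in L None. w \<in> {0..1}"
    unfolding L_def option.case using id_meas
    by (subst AE_distr_iff) (auto intro!: AE_I2 simp: \<mu>.space_eq)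
  have ind: "N.indep_vars (\<lambda>_. borel) ?X ?A"
    using fam I1 by (auto simp: sampling_family_def intro: N.indep_vars_subset)
  have rv: "?X j \<in> borel_measurable N" if "j \<in> ?A" for j
    using ind that unfolding N.indep_vars_def by blast
  have "distr N (PiM ?A (\<lambda>_. borel)) (\<lambda>\<omega>. \<lambda>j\<in>?A. ?X j \<omega>) = PiM ?A (\<lambda>j. distr N borel (?X j))"
    using N.indep_vars_iff_distr_eq_PiM'[of ?A ?X "\<lambda>_. borel"] rv ind by simp
  also have "\<dots> = PiM ?A L"
    using fam I1 by (intro PiM_cong refl) (auto simp: sampling_family_def L_def)
  finally have joint: "distr N (PiM ?A (\<lambda>_. borel)) (\<lambda>\<omega>. \<lambda>j\<in>?A. ?X j \<omega>) = PiM ?A L" .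
  have setsA: "sets (PiM ?A L) = sets (PiM ?A (\<lambda>_. borel))"
    by (intro sets_PiM_cong refl setsL)
  define B where "B = {z \<in> space (PiM ?A (\<lambda>_. borel::real measure)). \<forall>i\<in>I. z None \<le> z (Some i) \<longleftrightarrow> i \<in> S}"
  have B_sets: "B \<in> sets (PiM ?A (\<lambda>_. borel))"
    unfolding B_def using fin(1)
  proof (intro sets.sets_Collect_finite_All)
    fix i assume "i \<in> I"
    then have m: "(\<lambda>z. z None) \<in> borel_measurable (PiM ?A (\<lambda>_. borel::real measure))"
      "(\<lambda>z. z (Some i)) \<in> borel_measurable (PiM ?A (\<lambda>_. borel::real measure))"
      by (auto intro!: measurable_component_singleton)
    show "{z \<in> space (PiM ?A (\<lambda>_. borel::real measure)). z None \<le> z (Some i) \<longleftrightarrow> i \<in> S}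
          \<in> sets (PiM ?A (\<lambda>_. borel))"
      using borel_measurable_le[OF m] borel_measurable_less[OF m(2,1)]
      by (cases "i \<in> S") (simp_all add: not_le)
  qed
  have event: "{\<omega> \<in> space N. random_set W Y \<omega> \<inter> I = S} =
        (\<lambda>\<omega>. \<lambda>j\<in>?A. ?X j \<omega>) -` B \<inter> space N"
    using S I1 by (auto simp: B_def space_PiM random_set_def)
  have "emeasure N {\<omega> \<in> space N. random_set W Y \<omega> \<inter> I = S} = emeasure (PiM ?A L) B"
    unfolding event joint[symmetric] using B_sets rv
    by (intro emeasure_distr[symmetric] measurable_restrict) auto
  also have "\<dots> = (\<integral>\<^sup>+z. indicator B z \<partial>PiM ?A L)"
    using B_sets by (simp add: setsA)
  also have "\<dots> = (\<integral>\<^sup>+w. (\<integral>\<^sup>+z. indicator B (z(None := w)) \<partial>PiM (Some ` I) L) \<partial>L None)"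
    using fin B_sets
    by (intro L.product_nn_integral_insert_rev borel_measurable_indicator) (auto simp: setsA)
  also have "\<dots> = (\<integral>\<^sup>+w. ennreal ((1 - w) ^ card S * w ^ (card I - card S)) \<partial>L None)"
  proof (rule nn_integral_cong_AE, rule AE_mp[OF unit AE_I2], rule impI)
    fix w :: real assume w: "w \<in> {0..1}"
    define C where "C j = (if the j \<in> S then {w..} else {..<w})" for j
    have C_sets: "C j \<in> sets (L j)" for j by (simp add: C_def setsL)
    have "(\<integral>\<^sup>+z. indicator B (z(None := w)) \<partial>PiM (Some ` I) L) =
          (\<integral>\<^sup>+z. indicator (PiE (Some ` I) C) z \<partial>PiM (Some ` I) L)"
    proof (intro nn_integral_cong)
      fix z assume "z \<in> space (PiM (Some ` I) L)"
      then have z: "z \<in> extensional (Some ` I)"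
        by (simp add: space_PiM PiE_iff)
      have "z(None := w) \<in> B \<longleftrightarrow> z \<in> PiE (Some ` I) C"
        using z by (auto simp: B_def C_def space_PiM PiE_iff extensional_def not_le)
      then show "indicator B (z(None := w)) = (indicator (PiE (Some ` I) C) z :: ennreal)"
        by (simp add: indicator_def)
    qed
    also have "\<dots> = emeasure (PiM (Some ` I) L) (PiE (Some ` I) C)"
      using fin C_sets by (intro nn_integral_indicator sets_PiM_I_finite) auto
    also have "\<dots> = (\<Prod>j\<in>Some ` I. emeasure (L j) (C j))"
      using fin C_sets by (intro L.emeasure_PiM) auto
    also have "\<dots> = (\<Prod>i\<in>I. if i \<in> S then ennreal (1 - w) else ennreal w)"
      by (subst prod.reindex) (auto simp: L_def C_def emeasure_uniform01[OF w] simp del: emeasure_uniform_measure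
          intro!: prod.cong)
    also have "\<dots> = ennreal (1 - w) ^ card S * ennreal w ^ (card I - card S)"
      using fin S by (simp add: prod.If_cases Int_absorb1 card_Diff_subset flip: Diff_eq)
    also have "\<dots> = ennreal ((1 - w) ^ card S * w ^ (card I - card S))"
      using w by (simp add: ennreal_power ennreal_mult)
    finally show "(\<integral>\<^sup>+z. indicator B (z(None := w)) \<partial>PiM (Some ` I) L) = \<dots>" .
  qed
  also have "\<dots> = (\<integral>\<^sup>+w. ennreal ((1 - w) ^ card S * w ^ (card I - card S)) \<partial>\<mu>)"
    unfolding L_def option.case by (intro nn_integral_distr id_meas) simp
  also have "\<dots> = ennreal (\<integral>w. (1 - w) ^ card S * w ^ (card I - card S) \<partial>\<mu>)"
    using \<mu>.integrable_powers[of "card I - card S" "card S"]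
    by (intro nn_integral_eq_integral AE_I2) (auto simp: \<mu>.space_eq mult.commute)
  finally show ?thesis
    using \<mu>.integral_powers_nonneg[of "card I - card S" "card S"]
    by (simp add: N.emeasure_eq_measure mult.commute)
qed

section \<open>Characterisation of intricacies\<close>

theorem theorem1p2:
  fixes d :: nat
    and c :: "nat set \<Rightarrow> nat set \<Rightarrow> real"
  assumes "d \<ge> 2"
    and "coefficient_system c"
    and "infinite (UNIV :: 'w set)"
  shows
    \<comment> \<open>(1)\<close>
    "(intricacy d (mi_functional c :: 'w functional) \<longleftrightarrow> (\<exists>\<mu>. represents \<mu> c)) \<and>
     (\<forall>\<mu> (N :: 'v measure) W Y.
        intricacy d (mi_functional c :: 'w functional) \<and> represents \<mu> c \<and>
        sampling_family \<mu> N W Y \<longrightarrow>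
        (\<forall>I \<in> Fpow {1..}. \<forall>S. S \<subseteq> I \<longrightarrow>
           c I S = measure N {\<omega> \<in> space N. random_set W Y \<omega> \<inter> I = S})) \<and>
     \<comment> \<open>(2)\<close>
     (intricacy d (mi_functional c :: 'w functional) \<longrightarrow>
        (\<exists>!\<mu>. represents \<mu> c) \<and>
        (\<forall>c' \<mu> \<mu>'. coefficient_system c' \<and>
           agree d (mi_functional c :: 'w functional) (mi_functional c') \<and>
           represents \<mu> c \<and> represents \<mu>' c' \<longrightarrow> \<mu>' = \<mu>) \<and>
        (\<forall>\<mu>. represents \<mu> c \<longrightarrow>
           (non_null c \<longleftrightarrow> measure \<mu> {0<..<1} > 0) \<and>
           (non_null c \<longrightarrow>
              (\<forall>I \<in> Fpow {1..}. \<forall>S. S \<subseteq> I \<and> S \<noteq> {} \<and> S \<noteq> I \<longrightarrow> c I S > 0)))) \<and>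
     \<comment> \<open>(3)\<close>
     (\<forall>I \<in> Fpow {1 :: nat..}. \<forall>S. S \<subseteq> I \<longrightarrow>
        1 / (real (card I) + 1) * (1 / real (card I choose card S)) =
        (\<integral>x. x ^ card S * (1 - x) ^ (card I - card S) \<partial>lebesgue01)) \<and>
     coefficient_system neural_coeff \<and>
     represents lebesgue01 neural_coeff \<and>
     exchangeable d (mi_functional neural_coeff :: 'w functional) \<and>
     weakly_additive d (mi_functional neural_coeff :: 'w functional) \<and>
     intricacy d (mi_functional neural_coeff :: 'w functional)"
proof -
  note inf = assms(3) and d = assms(1) and c = assms(2)
  have iff: "intricacy d (mi_functional c :: 'w functional) \<longleftrightarrow> (\<exists>\<mu>. represents \<mu> c)"
    using intricacy_imp_represented[OF inf d c] represents_imp_intricacy(3) by blast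
  have sampling: "c I S = measure N {\<omega> \<in> space N. random_set W Y \<omega> \<inter> I = S}"
    if rep: "represents \<mu> c" and fam: "sampling_family \<mu> N W Y" and I: "I \<in> Fpow {1..}" and S: "S \<subseteq> I"
    for \<mu> and N :: "'v measure" and W Y I S
  proof -
    have "symmetric_prob \<mu>" using rep by (simp add: represents_def)
    \<comment> \<open>The event \<open>Y i \<ge> w\<close> has probability \<open>1 - w\<close>, so symmetry is needed to exchange the exponents.\<close>
    from symmetric_prob_integral_powers[OF this, of "card S" "card I - card S"] show ?thesis
      using sampling_family_law[OF represents_unit_interval_prob[OF rep] fam I S]
      by (simp add: representsD[OF rep I S] bernoulli_mixture_def mult.commute)
  qed
  have unique_c: "\<mu>' = \<mu>" if "represents \<mu> c" "represents \<mu>' c" for \<mu> \<mu>'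
    using that by (rule represents_unique) (rule refl)
  have unique: "\<mu>' = \<mu>"
    if "coefficient_system c'" "agree d (mi_functional c :: 'w functional) (mi_functional c')"
      "represents \<mu> c" "represents \<mu>' c'" for c' \<mu> \<mu>'
    using that(3,4) agree_imp_containment_prob_eq[OF inf d c that(1,2)] by (rule represents_unique)
  have pos: "c I S > 0"
    if "represents \<mu> c" "non_null c" "I \<in> Fpow {1..}" "S \<subseteq> I" "S \<noteq> {}" "S \<noteq> I" for \<mu> I S
    using represents_pos_iff[OF that(1,3-6)] represents_non_null_iff[OF that(1)] that(2) by blast
  have neural: "1 / (real (card I) + 1) * (1 / real (card I choose card S)) =
      (\<integral>x. x ^ card S * (1 - x) ^ (card I - card S) \<partial>lebesgue01)"
    if "I \<in> Fpow {1..}" "S \<subseteq> I" for I S :: "nat set"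
    using neural_coeff_eq_integral[of I S] that by (simp add: Fpow_def neural_coeff_def)
  show ?thesis
    apply (intro conjI)
    subgoal by (rule iff)
    subgoal using sampling by blast
    subgoal using iff unique_c unique represents_non_null_iff pos by (intro impI conjI) blast+
    subgoal using neural by blast
    subgoal by (rule represents_imp_coefficient_system[OF represents_neural_coeff])
    subgoal by (rule represents_neural_coeff)
    subgoal by (rule represents_imp_intricacy[OF represents_neural_coeff])
    subgoal by (rule represents_imp_intricacy[OF represents_neural_coeff])
    subgoal by (rule represents_imp_intricacy[OF represents_neural_coeff])
    done
qed

end
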